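(* Fix an integer $k\ge2$ and a real number $f_k>k$. Suppose that, for every $0<x\le 1/f_k$, all independent, identically distributed random variables $Z_1,\ldots,Z_k$ with values in $[0,1]$ and $\mathbb E Z_i\le x$ satisfy $$\mathbb P(Z_1+\cdots+Z_k\ge1)\le q_k(x),$$ with equality if and only if their common law is $\mu_x=(1-x)\delta_0+x\delta_1$. Let $0<a\le 1/f_k$ and $\eta>0$. Then there exist $\varepsilon>0$ and $n_0$ such that the following holds for all integers $n\ge n_0$ and $s$ with $$an\le s\le\frac{n}{f_k}.$$ If $\mathcal F\subseteq\binom{[n]}k$, $\nu(\mathcal F)\le s$, and $$|\mathcal F|\ge M_k(n,s)-\varepsilon n^k,$$ then some $S\in\binom{[n]}s$ satisfies $$|\mathcal F\mathbin\triangle\mathcal A(S)|\le\eta n^k.$$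
   Context: $q_k(x):=1-(1-x)^k$, and $\delta_c$ is the unit point mass at $c$. $[n]=\{1,\dots,n\}$, and for a finite set $V$, $\binom Vk$ is the collection of all $k$-element subsets of $V$. A matching is a collection of pairwise disjoint members (edges) of a family; $\nu(\mathcal F)$ is the maximum size of a matching contained in $\mathcal F$. For $S\subseteq[n]$, $\mathcal A(S)=\{E\in\binom{[n]}k: E\cap S\ne\varnothing\}$. Also $M_k(n,s):=\binom nk-\binom{n-s}k$, and $\triangle$ denotes symmetric difference. *)

theory Defs
  imports "HOL-Probability.Probability" "HOL-Library.Ramsey"
begin

text \<open>Meaningful for a probability space \<open>P\<close>.\<close>

definition iid_vars :: "'a measure \<Rightarrow> ('i \<Rightarrow> 'a \<Rightarrow> real) \<Rightarrow> 'i set \<Rightarrow> bool" where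
  "iid_vars P Z I \<longleftrightarrow>
     prob_space.indep_vars P (\<lambda>_. borel) Z I \<and>
     (\<forall>i\<in>I. \<forall>j\<in>I. distr P borel (Z i) = distr P borel (Z j))"

definition q :: "nat \<Rightarrow> real \<Rightarrow> real" where
  "q k x = 1 - (1 - x) ^ k"

text \<open>The law \<open>(1 - x) \<delta>\<^sub>0 + x \<delta>\<^sub>1\<close>, meant for \<open>0 \<le> x \<le> 1\<close>;
  the library's \<^const>\<open>return\<close> is the unit point mass.\<close>

definition mu :: "real \<Rightarrow> real measure" where
  "mu x = measure_of UNIV (sets borel)
     (\<lambda>A. ennreal (1 - x) * emeasure (return borel 0) A + ennreal x * emeasure (return borel 1) A)"

lemma sets_mu [simp]: "sets (mu x) = sets borel"
  unfolding mu_def by (metis sets.sigma_sets_eq sets_measure_of space_borel top_greatest Pow_UNIV)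

lemma emeasure_mu:
  assumes A: "A \<in> sets borel"
  shows "emeasure (mu x) A =
    ennreal (1 - x) * emeasure (return borel 0) A + ennreal x * emeasure (return borel 1) A"
proof -
  let ?f = "\<lambda>A. ennreal (1 - x) * emeasure (return borel (0::real)) A
    + ennreal x * emeasure (return borel (1::real)) A"
  have "countably_additive (sets borel) ?f"
  proof (rule countably_additiveI)
    fix B :: "nat \<Rightarrow> real set"
    assume B: "range B \<subseteq> sets borel" "disjoint_family B"
    have s: "(\<Sum>i. emeasure (return borel c) (B i)) = emeasure (return borel c) (\<Union>i. B i)"
      for c :: real
      using B by (intro suminf_emeasure) auto
    have "(\<Sum>i. ?f (B i)) =
      ennreal (1 - x) * (\<Sum>i. emeasure (return borel (0::real)) (B i))
      + ennreal x * (\<Sum>i. emeasure (return borel (1::real)) (B i))"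
      by (subst suminf_add [symmetric]) (auto simp: ennreal_suminf_cmult)
    then show "(\<Sum>i. ?f (B i)) = ?f (\<Union>i. B i)" by (simp only: s)
  qed
  moreover have "positive (sets borel) ?f" by (simp add: positive_def)
  moreover have "sigma_algebra (UNIV :: real set) (sets borel)"
    using sets.sigma_algebra_axioms [of "borel :: real measure"] by simp
  ultimately show ?thesis
    unfolding mu_def using A by (intro emeasure_measure_of_sigma)
qed

text \<open>Meaningful for finite \<open>F\<close>; the empty matching keeps the \<^const>\<open>Max\<close> nonempty.\<close>

definition matching_number :: "'a set set \<Rightarrow> nat" where
  "matching_number F = Max (card ` {M. M \<subseteq> F \<and> disjoint M})"

definition meeting_family :: "nat \<Rightarrow> nat \<Rightarrow> nat set \<Rightarrow> nat set set" where
  "meeting_family k n S = {E \<in> [{1..n}]\<^bsup>k\<^esup>. E \<inter> S \<noteq> {}}"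

definition M_bound :: "nat \<Rightarrow> nat \<Rightarrow> nat \<Rightarrow> real" where
  "M_bound k n s = real (n choose k) - real ((n - s) choose k)"

end

theory Submission
  imports Defs
begin

text \<open>
  Let \<open>F\<close> have matching number at most \<open>s\<close> and let \<open>x = s / n\<close>.  The proof replaces \<open>F\<close> by a
  weight function \<open>W\<close> on the vertices and reads the weight of a random vertex as a random variable.

  \<^emph>\<open>A nearly optimal fractional cover\<close> (\<open>fractional_cover_of_almost_all\<close>).  There is
  \<open>W: [n] \<rightarrow> [0,1]\<close> of total weight at most \<open>s + o(n)\<close> such that all but \<open>o(n\<^sup>k)\<close> edges of \<open>F\<close> have
  weight at least 1.  The fractional matching number of \<open>F\<close> itself may exceed \<open>s\<close> by a linear amount,
  so some edges have to be given up.  To find them, colour the vertices with boundedly many colours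
  so that almost every edge has a \<^emph>\<open>robust\<close> colour pattern: an edge remains in the box of the pattern
  whenever each of its colour classes is shrunk to an \<open>\<epsilon>\<close>-fraction (\<open>robust_colouring\<close>; the potential
  that grows under refinement is the number of tuples lying in a box without edges).  Along
  robust patterns a fractional matching of patterns, rounded down, is realised greedily by pairwise
  disjoint edges (\<open>greedy_matching_along_patterns\<close>), since an edge is available until some
  class is nearly used up.  Thus fractional matchings of robust patterns have weight at most
  \<open>s + O(1)\<close>, and linear programming duality (\<open>approximate_lp_duality\<close>, up to a factor \<open>1 + \<beta>\<close>)
  yields a fractional cover, which is a function of the colour only.

  \<^emph>\<open>Compactness\<close> (\<open>law_stability\<close>).  Choose \<open>k\<close> vertices independently and uniformly.  Their
  weights are independent and identically distributed with mean at most \<open>x + o(1)\<close>, and the sum is at least 1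
  with probability at least \<open>k! |F| / n\<^sup>k - o(1)\<close>, which is at least \<open>q\<^sub>k(x) - o(1)\<close> if \<open>|F|\<close> almost
  attains \<open>M\<^sub>k(n,s)\<close>.  Any weak limit of such laws
  attains the bound \<open>q\<^sub>k\<close>, hence is the two-point law, which puts mass \<open>x\<close> on \<open>[1/k, 1]\<close>.
  Therefore at most \<open>s + o(n)\<close> vertices have weight at least \<open>1/k\<close>.

  \<^emph>\<open>Conclusion\<close> (\<open>cover_support_gives_star\<close>).  A set of \<open>k\<close> vertices of weight at least 1 contains
  a vertex of weight at least \<open>1/k\<close>.  So almost all of \<open>F\<close> meets these vertices, and up to \<open>o(n)\<close>
  of them they form a set \<open>S\<close> of size \<open>s\<close>.  As \<open>|F|\<close> is almost \<open>|\<A>(S)|\<close>, the symmetric difference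
  is small.
\<close>

section \<open>Laws that almost attain the two-point bound\<close>

text \<open>The half of the portmanteau theorem used for closed sets: mass on a closed ray can only
  jump up in a weak limit.  The indicator of \<open>{t..}\<close> is bounded by continuous functions that
  vanish below \<open>t - 1/(j+1)\<close>, and these rays shrink to \<open>{t..}\<close>.\<close>
lemma weak_limit_closed_ray:
  fixes t l :: real
  assumes \<mu>: "\<And>n. real_distribution (\<mu> n)" and M: "real_distribution M"
    and conv: "weak_conv_m \<mu> M"
    and p: "\<And>n. p n \<le> measure (\<mu> n) {t..}" and l: "p \<longlonglongrightarrow> l"
  shows "l \<le> measure M {t..}"
proof -
  interpret M: real_distribution M by fact
  have mono: "l \<le> measure M {t - 1 / real (Suc j)..}" for j
  proof -
    define a where "a = t - 1 / real (Suc j)"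
    have at: "a < t" by (simp add: a_def)
    have bd: "norm (cts_step a t x) \<le> 1" for x
      using at by (auto simp: cts_step_def divide_simps)
    have ucont: "isCont (cts_step a t) x" for x
      using cts_step_uniformly_continuous[OF at] uniformly_continuous_imp_continuous
        continuous_on_eq_continuous_at by blast
    have lim: "(\<lambda>n. integral\<^sup>L (\<mu> n) (cts_step a t)) \<longlonglongrightarrow> integral\<^sup>L M (cts_step a t)"
      by (rule weak_conv_imp_integral_bdd_continuous_conv[where B = 1, OF \<mu> M conv ucont bd])
    have le: "p n \<le> 1 - integral\<^sup>L (\<mu> n) (cts_step a t)" for n
    proof -
      interpret N: real_distribution "\<mu> n" by fact
      have "integral\<^sup>L (\<mu> n) (cts_step a t) \<le> integral\<^sup>L (\<mu> n) (indicator {..<t})"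
        by (intro integral_mono N.integrable_cts_step integrable_real_indicator)
          (use at in \<open>auto simp: cts_step_def field_simps less_top[symmetric] split: split_indicator\<close>)
      also have "\<dots> = N.prob {..<t}" by simp
      also have "\<dots> = 1 - N.prob {t..}"
        by (subst N.prob_compl[symmetric]) (auto intro!: arg_cong[where f = N.prob])
      finally show ?thesis using p[of n] by linarith
    qed
    have "l \<le> 1 - integral\<^sup>L M (cts_step a t)"
      by (rule LIMSEQ_le[OF l tendsto_diff[OF tendsto_const lim]]) (use le in auto)
    also have "\<dots> \<le> 1 - cdf M a" using M.cdf_cts_step(1)[OF at] by simp
    also have "\<dots> = measure M {a<..}"
      unfolding cdf_def
      by (subst M.prob_compl[symmetric]) (auto intro!: arg_cong[where f = M.prob])
    also have "\<dots> \<le> measure M {a..}"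
      by (rule M.finite_measure_mono) auto
    finally show ?thesis by (simp add: a_def)
  qed
  have "(\<lambda>j. measure M {t - 1 / real (Suc j)..}) \<longlonglongrightarrow> measure M (\<Inter>j. {t - 1 / real (Suc j)..})"
    by (rule M.finite_Lim_measure_decseq) (auto simp: decseq_def field_simps intro: order_trans[rotated])
  also have "(\<Inter>j. {t - 1 / real (Suc j)..}) = {t..}"
  proof (intro equalityI subsetI)
    fix x assume "x \<in> (\<Inter>j. {t - 1 / real (Suc j)..})"
    then have "t - 1 / real (Suc j) \<le> x" for j by auto
    moreover have "(\<lambda>j. t - 1 / real (Suc j)) \<longlonglongrightarrow> t - 0"
      by (intro tendsto_intros LIMSEQ_Suc[OF lim_1_over_n])
    ultimately show "x \<in> {t..}" using LIMSEQ_le_const2[of _ "t - 0"] by fastforce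
  qed (auto intro: order_trans[rotated])
  finally show ?thesis by (rule LIMSEQ_le_const) (use mono in auto)
qed

definition unit_clamp :: "real \<Rightarrow> real" where
  "unit_clamp x = max 0 (min 1 x)"

lemma unit_clamp_bounds: "0 \<le> unit_clamp x" "unit_clamp x \<le> 1"
  by (auto simp: unit_clamp_def)

lemma unit_clamp_id: "x \<in> {0..1} \<Longrightarrow> unit_clamp x = x"
  by (auto simp: unit_clamp_def)

lemma unit_clamp_cont: "isCont unit_clamp x"
  unfolding unit_clamp_def[abs_def] by (intro continuous_intros)

lemma unit_clamp_measurable [measurable]: "unit_clamp \<in> borel_measurable borel"
  unfolding unit_clamp_def[abs_def] by measurable

text \<open>Laws on the unit interval are tight, so Helly's theorem applies.  Describing the limit as
  the image of some law under clamping makes it live on the unit interval by construction: composing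
  the test functions with the clamp does not change their integrals along the sequence.\<close>
lemma weak_limit_unit_interval:
  fixes \<mu> :: "nat \<Rightarrow> real measure"
  assumes \<mu>: "\<And>n. real_distribution (\<mu> n)" and AE: "\<And>n. AE x in \<mu> n. x \<in> {0..1}"
  obtains r M where "strict_mono r" "real_distribution M"
    "weak_conv_m (\<mu> \<circ> r) (distr M borel unit_clamp)"
    "(\<lambda>n. integral\<^sup>L (\<mu> (r n)) unit_clamp) \<longlonglongrightarrow> integral\<^sup>L M unit_clamp"
proof -
  have "tight \<mu>"
    unfolding tight_def
  proof (intro conjI allI impI \<mu>)
    fix \<epsilon> :: real assume "\<epsilon> > 0"
    have "measure (\<mu> n) {-1<..2} > 1 - \<epsilon>" for n
    proof -
      interpret N: real_distribution "\<mu> n" by fact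
      have "N.prob {-1<..2} = 1"
        by (subst N.prob_eq_1) (use AE[of n] in \<open>auto elim: eventually_mono\<close>)
      with \<open>\<epsilon> > 0\<close> show ?thesis by simp
    qed
    then show "\<exists>a b. a < b \<and> (\<forall>n. measure (\<mu> n) {a<..b} > 1 - \<epsilon>)"
      by (intro exI[of _ "-1"] exI[of _ 2]) auto
  qed
  from tight_imp_convergent_subsubsequence[OF this strict_mono_id] obtain r M where
    r: "strict_mono r" and M: "real_distribution M" and conv: "weak_conv_m (\<mu> \<circ> r) M"
    by auto
  interpret M: real_distribution M by fact
  have lim: "(\<lambda>n. integral\<^sup>L ((\<mu> \<circ> r) n) g) \<longlonglongrightarrow> integral\<^sup>L M g"
    if "\<And>x. isCont g x" "\<And>x. \<bar>g x\<bar> \<le> 1" for g :: "real \<Rightarrow> real"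
    by (rule weak_conv_imp_integral_bdd_continuous_conv[where B = 1, OF _ M conv])
      (use that \<mu> in auto)
  have "weak_conv_m (\<mu> \<circ> r) (distr M borel unit_clamp)"
  proof (rule integral_bdd_continuous_conv_imp_weak_conv)
    fix g :: "real \<Rightarrow> real" assume g: "\<And>x. isCont g x" "\<And>x. \<bar>g x\<bar> \<le> 1"
    then have [measurable]: "g \<in> borel_measurable borel"
      by (intro borel_measurable_continuous_onI continuous_at_imp_continuous_on) auto
    have "(\<lambda>n. integral\<^sup>L ((\<mu> \<circ> r) n) (\<lambda>x. g (unit_clamp x))) \<longlonglongrightarrow> integral\<^sup>L M (\<lambda>x. g (unit_clamp x))"
      by (rule lim) (use g in \<open>auto intro!: isCont_o2[OF unit_clamp_cont]\<close>)
    also have "integral\<^sup>L M (\<lambda>x. g (unit_clamp x)) = integral\<^sup>L (distr M borel unit_clamp) g"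
      by (rule integral_distr[symmetric]) auto
    also have "(\<lambda>n. integral\<^sup>L ((\<mu> \<circ> r) n) (\<lambda>x. g (unit_clamp x))) = (\<lambda>n. integral\<^sup>L ((\<mu> \<circ> r) n) g)"
    proof
      fix n
      interpret N: real_distribution "\<mu> (r n)" using \<mu> by simp
      show "integral\<^sup>L ((\<mu> \<circ> r) n) (\<lambda>x. g (unit_clamp x)) = integral\<^sup>L ((\<mu> \<circ> r) n) g"
        unfolding comp_def by (rule integral_cong_AE)
          (use AE[of "r n"] in \<open>auto simp: unit_clamp_id simp del: atLeastAtMost_iff elim: eventually_mono\<close>)
    qed
    finally show "(\<lambda>n. integral\<^sup>L ((\<mu> \<circ> r) n) g) \<longlonglongrightarrow> integral\<^sup>L (distr M borel unit_clamp) g" .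
  qed (use \<mu> in \<open>auto\<close>)
  moreover have "(\<lambda>n. integral\<^sup>L (\<mu> (r n)) unit_clamp) \<longlonglongrightarrow> integral\<^sup>L M unit_clamp"
    using lim[of unit_clamp] unit_clamp_cont unit_clamp_bounds by (simp add: abs_le_iff order_trans[OF _ unit_clamp_bounds(1)])
  ultimately show ?thesis using that r M by blast
qed

text \<open>Coordinates of a product space, clamped pointwise so that the values lie in the unit
  interval everywhere and not merely almost everywhere.\<close>
lemma iid_clamped_copies:
  fixes M :: "real measure" and k :: nat
  assumes M: "real_distribution M" and k: "k \<ge> 1"
  defines "P \<equiv> PiM {1..k} (\<lambda>_. M)" and "Z \<equiv> \<lambda>i \<omega>. unit_clamp (\<omega> i)"
  shows "prob_space P" "iid_vars P Z {1..k}"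
    "\<And>i. i \<in> {1..k} \<Longrightarrow> distr P borel (Z i) = distr M borel unit_clamp"
    "\<And>i. i \<in> {1..k} \<Longrightarrow> prob_space.expectation P (Z i) = integral\<^sup>L M unit_clamp"
proof -
  interpret M: real_distribution M by fact
  show P: "prob_space P"
    unfolding P_def by (intro prob_space_PiM M.prob_space_axioms)
  interpret P: prob_space P by fact
  have [measurable]: "(\<lambda>\<omega>. \<omega> i) \<in> measurable P M" if "i \<in> {1..k}" for i
    unfolding P_def using that by simp
  have comp: "distr P M (\<lambda>\<omega>. \<omega> i) = M" if "i \<in> {1..k}" for i
    unfolding P_def using distr_PiM_component[of "{1..k}" "\<lambda>_. M" i] that M.prob_space_axioms by auto
  have "P.indep_vars (\<lambda>_. M) (\<lambda>i \<omega>. \<omega> i) {1..k}"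
  proof (subst P.indep_vars_iff_distr_eq_PiM')
    have "distr P (PiM {1..k} (\<lambda>_. M)) (\<lambda>x. \<lambda>i\<in>{1..k}. x i) = distr P P (\<lambda>x. x)"
      by (intro distr_cong) (auto simp: P_def space_PiM PiE_def extensional_restrict)
    also have "\<dots> = P" by simp
    also have "P = PiM {1..k} (\<lambda>i. distr P M (\<lambda>\<omega>. \<omega> i))"
      unfolding P_def by (intro PiM_cong refl) (use comp in \<open>auto simp: P_def\<close>)
    finally show "distr P (PiM {1..k} (\<lambda>_. M)) (\<lambda>x. \<lambda>i\<in>{1..k}. x i) = PiM {1..k} (\<lambda>i. distr P M (\<lambda>\<omega>. \<omega> i))" .
  qed (use k in auto)
  then have indep: "P.indep_vars (\<lambda>_. borel) Z {1..k}"
    unfolding Z_def by (rule P.indep_vars_compose2) simp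
  show law: "distr P borel (Z i) = distr M borel unit_clamp" if "i \<in> {1..k}" for i
  proof -
    have "distr M borel unit_clamp = distr (distr P M (\<lambda>\<omega>. \<omega> i)) borel unit_clamp"
      using comp[OF that] by simp
    also have "\<dots> = distr P borel (Z i)"
      unfolding Z_def by (subst distr_distr) (use that in \<open>auto simp: comp_def\<close>)
    finally show ?thesis ..
  qed
  then show "iid_vars P Z {1..k}" using indep unfolding iid_vars_def by simp
  show "P.expectation (Z i) = integral\<^sup>L M unit_clamp" if "i \<in> {1..k}" for i
  proof -
    have "P.expectation (Z i) = integral\<^sup>L (distr P M (\<lambda>\<omega>. \<omega> i)) unit_clamp"
      unfolding Z_def by (subst integral_distr) (use that in auto)
    then show ?thesis using comp[OF that] by simp
  qed
qed

text \<open>The coordinates of a uniformly random tuple are independent; on the level of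
  characteristic functions this is the expansion of a product of sums.\<close>
lemma char_uniform_sum:
  fixes W :: "'a \<Rightarrow> real"
  assumes V: "finite V" "V \<noteq> {}"
  shows "char (distr (measure_pmf (pmf_of_set ({1..k} \<rightarrow>\<^sub>E V))) borel (\<lambda>\<omega>. \<Sum>j\<in>{1..k}. W (\<omega> j))) t
    = char (distr (measure_pmf (pmf_of_set V)) borel W) t ^ k"
proof -
  let ?T = "{1..k} \<rightarrow>\<^sub>E V"
  have T: "finite ?T" "?T \<noteq> {}" using V by (auto intro!: finite_PiE simp: PiE_eq_empty_iff)
  have unif: "(LINT x|measure_pmf (pmf_of_set A). h x) = (\<Sum>x\<in>A. h x) / of_nat (card A)"
    if "finite A" "A \<noteq> {}" for A :: "'b set" and h :: "'b \<Rightarrow> complex"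
    using that by (subst integral_measure_pmf[of A])
      (auto simp: sum_divide_distrib scaleR_conv_of_real divide_simps)
  have "char (distr (measure_pmf (pmf_of_set ?T)) borel (\<lambda>\<omega>. \<Sum>j\<in>{1..k}. W (\<omega> j))) t
      = (\<Sum>\<omega>\<in>?T. iexp (t * (\<Sum>j\<in>{1..k}. W (\<omega> j)))) / of_nat (card ?T)"
    unfolding char_def by (subst integral_distr) (use unif[OF T] in auto)
  also have "(\<Sum>\<omega>\<in>?T. iexp (t * (\<Sum>j\<in>{1..k}. W (\<omega> j)))) = (\<Sum>\<omega>\<in>?T. \<Prod>j\<in>{1..k}. iexp (t * W (\<omega> j)))"
    by (intro sum.cong refl) (simp add: exp_sum[symmetric] sum_distrib_left sum_distrib_right)
  also have "\<dots> = (\<Prod>j\<in>{1..k}. \<Sum>v\<in>V. iexp (t * W v))"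
    by (rule prod_sum_PiE[symmetric]) (use V in auto)
  also have "\<dots> / of_nat (card ?T) = ((\<Sum>v\<in>V. iexp (t * W v)) / of_nat (card V)) ^ k"
    by (simp add: card_PiE power_divide)
  also have "(\<Sum>v\<in>V. iexp (t * W v)) / of_nat (card V) = char (distr (measure_pmf (pmf_of_set V)) borel W) t"
    unfolding char_def by (subst integral_distr) (use unif[OF V] in auto)
  finally show ?thesis .
qed


text \<open>For mean at most \<open>x \<le> 1/f\<close>, the two-point law is the unique maximiser of the probability that
  \<open>k\<close> independent copies sum to at least 1.\<close>
definition two_point_extremal :: "nat \<Rightarrow> real \<Rightarrow> bool" where
  "two_point_extremal k f \<longleftrightarrow>
    (\<forall>x (P :: (nat \<Rightarrow> real) measure) (Z :: nat \<Rightarrow> (nat \<Rightarrow> real) \<Rightarrow> real).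
      0 < x \<longrightarrow> x \<le> 1 / f \<longrightarrow> prob_space P \<longrightarrow> iid_vars P Z {1..k} \<longrightarrow>
      (\<forall>i\<in>{1..k}. \<forall>\<omega>\<in>space P. Z i \<omega> \<in> {0..1}) \<longrightarrow>
      (\<forall>i\<in>{1..k}. prob_space.expectation P (Z i) \<le> x) \<longrightarrow>
      prob_space.prob P {\<omega> \<in> space P. (\<Sum>i=1..k. Z i \<omega>) \<ge> 1} \<le> q k x \<and>
      (prob_space.prob P {\<omega> \<in> space P. (\<Sum>i=1..k. Z i \<omega>) \<ge> 1} = q k x \<longleftrightarrow>
        (\<forall>i\<in>{1..k}. distr P borel (Z i) = mu x)))"

text \<open>The law \<open>S\<close> of the sum of the copies enters only through its characteristic function, the form in
  which it arises as a weak limit.\<close>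
lemma extremal_law_upper_tail:
  assumes ext: "two_point_extremal k f" and k: "k \<ge> 2" and x: "0 < x" "x \<le> 1 / f"
    and M: "real_distribution M" and mean: "integral\<^sup>L M unit_clamp \<le> x"
  obtains S where "real_distribution S" "\<And>t. char S t = char (distr M borel unit_clamp) t ^ k"
    "q k x \<le> measure S {1..} \<Longrightarrow> measure (distr M borel unit_clamp) {1 / real k..} = x"
proof -
  define P where "P = PiM {1..k} (\<lambda>_. M)"
  define Z where "Z = (\<lambda>i (\<omega> :: nat \<Rightarrow> real). unit_clamp (\<omega> i))"
  define S where "S = distr P borel (\<lambda>\<omega>. \<Sum>i\<in>{1..k}. Z i \<omega>)"
  have k1: "k \<ge> 1" using k by simp
  have copies: "prob_space P" "iid_vars P Z {1..k}"
    "\<And>i. i \<in> {1..k} \<Longrightarrow> distr P borel (Z i) = distr M borel unit_clamp"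
    "\<And>i. i \<in> {1..k} \<Longrightarrow> prob_space.expectation P (Z i) = integral\<^sup>L M unit_clamp"
    using iid_clamped_copies[OF M k1] unfolding P_def Z_def by blast+
  interpret P: prob_space P by (rule copies(1))
  have indep: "P.indep_vars (\<lambda>_. borel) Z {1..k}"
    using copies(2) by (simp add: iid_vars_def)
  then have [measurable]: "Z i \<in> borel_measurable P" if "i \<in> {1..k}" for i
    using that unfolding P.indep_vars_def by auto
  have S: "real_distribution S" unfolding S_def by (intro P.real_distribution_distr) auto
  have char: "char S t = char (distr M borel unit_clamp) t ^ k" for t
  proof -
    have "char S t = (\<Prod>i\<in>{1..k}. char (distr P borel (Z i)) t)"
      unfolding S_def by (rule P.char_distr_sum[OF indep])
    also have "\<dots> = (\<Prod>i\<in>{1..k}. char (distr M borel unit_clamp) t)"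
      by (intro prod.cong refl arg_cong2[where f = char] copies(3))
    finally show ?thesis by simp
  qed
  have tail: "measure (distr M borel unit_clamp) {1 / real k..} = x" if q: "q k x \<le> measure S {1..}"
  proof -
    have "P.prob {\<omega> \<in> space P. (\<Sum>i=1..k. Z i \<omega>) \<ge> 1} = measure S {1..}"
      unfolding S_def by (subst measure_distr) (auto intro!: arg_cong[where f = P.prob])
    moreover have "P.prob {\<omega> \<in> space P. (\<Sum>i=1..k. Z i \<omega>) \<ge> 1} \<le> q k x \<and>
      (P.prob {\<omega> \<in> space P. (\<Sum>i=1..k. Z i \<omega>) \<ge> 1} = q k x \<longleftrightarrow>
        (\<forall>i\<in>{1..k}. distr P borel (Z i) = mu x))"
      using ext x copies(1,2) copies(4) mean unfolding two_point_extremal_def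
      by (auto simp: Z_def unit_clamp_bounds)
    ultimately have "distr P borel (Z 1) = mu x" using q k1 by auto
    then have law: "distr M borel unit_clamp = mu x" using copies(3)[of 1] k1 by simp
    have "emeasure (mu x) {1 / real k..} = ennreal x"
      using k by (subst emeasure_mu) (auto simp: divide_simps)
    then show ?thesis using x by (simp add: law measure_def)
  qed
  show ?thesis using that S char tail by blast
qed

lemma uniform_law:
  fixes g :: "'a \<Rightarrow> real"
  assumes A: "finite A" "A \<noteq> {}"
  defines "\<mu> \<equiv> distr (measure_pmf (pmf_of_set A)) borel g"
  shows "real_distribution \<mu>" "measure \<mu> {t..} = card {a \<in> A. t \<le> g a} / card A"
    "h \<in> borel_measurable borel \<Longrightarrow> integral\<^sup>L \<mu> h = (\<Sum>a\<in>A. h (g a)) / card A"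
proof -
  show "real_distribution \<mu>" unfolding \<mu>_def by (intro prob_space.real_distribution_distr[OF prob_space_measure_pmf]) simp
  show "measure \<mu> {t..} = card {a \<in> A. t \<le> g a} / card A"
    unfolding \<mu>_def using A
    by (subst measure_distr) (auto simp: measure_pmf_of_set vimage_def Int_def)
  show "integral\<^sup>L \<mu> h = (\<Sum>a\<in>A. h (g a)) / card A" if "h \<in> borel_measurable borel"
    unfolding \<mu>_def using A that by (subst integral_distr) (auto simp: integral_pmf_of_set)
qed

text \<open>If no \<open>\<delta>\<close> worked, there would be counterexamples \<open>(V, W, x)\<close> for \<open>\<delta> = 1/(N+1)\<close>.  Along a
  subsequence \<open>x\<close> converges to \<open>x0\<close> and the law of the weight of a random vertex converges weakly to
  some law; by Levy's theorem the \<open>k\<close>-fold sums converge to the sum of \<open>k\<close> copies of it.  Passing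
  to the limit in the bounds on mean and probability makes that law extremal for \<open>x0\<close>, so
  it has mass \<open>x0\<close> on the ray starting at \<open>1/k\<close>.  But each member of the sequence has mass more than
  \<open>x + \<rho>\<close> there, and mass on a closed ray survives in the limit.\<close>
lemma law_stability:
  fixes a f \<rho> :: real
  assumes ext: "two_point_extremal k f" and k: "k \<ge> 2" and a: "0 < a" and \<rho>: "0 < \<rho>"
  shows "\<exists>\<delta>::real>0. \<forall>(V :: 'a set) (W :: 'a \<Rightarrow> real) x.
    finite V \<and> V \<noteq> {} \<and> (\<forall>v\<in>V. W v \<in> {0..1}) \<and> a \<le> x \<and> x \<le> 1 / f \<and>
    sum W V \<le> (x + \<delta>) * card V \<and>
    (q k x - \<delta>) * card V ^ k \<le> card {\<omega> \<in> {1..k} \<rightarrow>\<^sub>E V. 1 \<le> (\<Sum>j\<in>{1..k}. W (\<omega> j))} \<longrightarrow>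
    card {v \<in> V. 1 / real k \<le> W v} \<le> (x + \<rho>) * card V" (is "\<exists>\<delta>>0. ?good \<delta>")
proof (rule ccontr)
  assume no: "\<not> ?thesis"
  define bad where "bad N V W x \<longleftrightarrow>
    finite V \<and> V \<noteq> {} \<and> (\<forall>v\<in>V. W v \<in> {0..1}) \<and> a \<le> x \<and> x \<le> 1 / f \<and>
    sum W V \<le> (x + 1 / real (Suc N)) * card V \<and>
    (q k x - 1 / real (Suc N)) * card V ^ k
      \<le> card {\<omega> \<in> {1..k} \<rightarrow>\<^sub>E V. 1 \<le> (\<Sum>j\<in>{1..k}. W (\<omega> j))} \<and>
    (x + \<rho>) * card V < card {v \<in> V. 1 / real k \<le> W v}"
    for N and V :: "'a set" and W :: "'a \<Rightarrow> real" and x :: real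
  have "\<exists>V W x. bad N V W x" for N
  proof (rule ccontr)
    assume none: "\<nexists>V W x. bad N V W x"
    have "?good (1 / real (Suc N))"
    proof (intro allI impI, rule ccontr, goal_cases)
      case (1 V W x)
      then have "bad N V W x" unfolding bad_def not_le by (elim conjE) (intro conjI)
      then show False using none by blast
    qed
    moreover have "1 / real (Suc N) > 0" by simp
    ultimately show False using no by blast
  qed
  then obtain V W x where bad: "\<And>N. bad N (V N) (W N) (x N)" by metis
  then have V: "\<And>N. finite (V N)" "\<And>N. V N \<noteq> {}" and W: "\<And>N v. v \<in> V N \<Longrightarrow> W N v \<in> {0..1}"
    and x: "\<And>N. a \<le> x N" "\<And>N. x N \<le> 1 / f"
    and mean: "\<And>N. sum (W N) (V N) \<le> (x N + 1 / real (Suc N)) * card (V N)"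
    and prob: "\<And>N. (q k (x N) - 1 / real (Suc N)) * card (V N) ^ k
      \<le> card {\<omega> \<in> {1..k} \<rightarrow>\<^sub>E V N. 1 \<le> (\<Sum>j\<in>{1..k}. W N (\<omega> j))}"
    and many: "\<And>N. (x N + \<rho>) * card (V N) < card {v \<in> V N. 1 / real k \<le> W N v}"
    unfolding bad_def by blast+
  have cV: "card (V N) > 0" for N using V by (simp add: card_gt_0_iff)
  have "seq_compact {a..1 / f}" by (intro compact_imp_seq_compact compact_Icc)
  moreover have "\<forall>n. x n \<in> {a..1 / f}" using x by simp
  ultimately obtain x0 s where x0: "x0 \<in> {a..1 / f}" and s: "strict_mono (s :: nat \<Rightarrow> nat)"
    and xs: "(x \<circ> s) \<longlonglongrightarrow> x0"
    by (rule seq_compactE)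
  define \<mu> where "\<mu> n = distr (measure_pmf (pmf_of_set (V (s n)))) borel (W (s n))" for n
  have \<mu>: "real_distribution (\<mu> n)" for n
    unfolding \<mu>_def by (rule uniform_law(1)[OF V])
  have AE: "AE y in \<mu> n. y \<in> {0..1}" for n
    unfolding \<mu>_def by (subst AE_distr_iff) (use V W in \<open>auto simp: AE_measure_pmf_iff\<close>)
  obtain r M where r: "strict_mono r"
    and M: "real_distribution M" and conv: "weak_conv_m (\<mu> \<circ> r) (distr M borel unit_clamp)"
    and means: "(\<lambda>n. integral\<^sup>L (\<mu> (r n)) unit_clamp) \<longlonglongrightarrow> integral\<^sup>L M unit_clamp"
    by (rule weak_limit_unit_interval[OF \<mu> AE])
  define h where "h = s \<circ> r"
  have h: "strict_mono h" unfolding h_def using s r by (rule strict_mono_o)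
  have xh: "(\<lambda>n. x (h n)) \<longlonglongrightarrow> x0"
    using LIMSEQ_subseq_LIMSEQ[OF xs r] by (simp add: h_def comp_def)
  have small: "(\<lambda>n. 1 / real (Suc (h n))) \<longlonglongrightarrow> 0"
    using LIMSEQ_subseq_LIMSEQ[OF LIMSEQ_Suc[OF lim_1_over_n] h] by (simp add: comp_def)
  interpret M: real_distribution M by fact
  have \<nu>: "real_distribution (distr M borel unit_clamp)" by (intro M.real_distribution_distr) simp
  have "integral\<^sup>L (\<mu> (r n)) unit_clamp \<le> x (h n) + 1 / real (Suc (h n))" for n
  proof -
    have "integral\<^sup>L (\<mu> (r n)) unit_clamp = (\<Sum>v\<in>V (h n). unit_clamp (W (h n) v)) / card (V (h n))"
      unfolding \<mu>_def h_def comp_def by (rule uniform_law(3)[OF V]) simp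
    also have "(\<Sum>v\<in>V (h n). unit_clamp (W (h n) v)) = sum (W (h n)) (V (h n))"
      by (intro sum.cong refl unit_clamp_id W)
    finally show ?thesis using mean[of "h n"] cV[of "h n"] by (simp add: divide_le_eq)
  qed
  then have "integral\<^sup>L M unit_clamp \<le> x0 + 0"
    by (intro LIMSEQ_le[OF means tendsto_add[OF xh small]]) auto
  then have mean0: "integral\<^sup>L M unit_clamp \<le> x0" by simp
  have "0 < x0" "x0 \<le> 1 / f" using x0 a by auto
  from extremal_law_upper_tail[OF ext k this M mean0] obtain S where
    S: "real_distribution S" and charS: "\<And>t. char S t = char (distr M borel unit_clamp) t ^ k"
    and tail: "q k x0 \<le> measure S {1..} \<Longrightarrow> measure (distr M borel unit_clamp) {1 / real k..} = x0"
    by blast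
  define T where "T n = ({1..k} \<rightarrow>\<^sub>E V (h n))" for n
  define \<sigma> where "\<sigma> n = distr (measure_pmf (pmf_of_set (T n))) borel (\<lambda>\<omega>. \<Sum>j\<in>{1..k}. W (h n) (\<omega> j))" for n
  have T: "finite (T n)" "T n \<noteq> {}" for n
    unfolding T_def using V by (auto intro!: finite_PiE simp: PiE_eq_empty_iff)
  have \<sigma>: "real_distribution (\<sigma> n)" for n unfolding \<sigma>_def by (rule uniform_law(1)[OF T])
  have "weak_conv_m \<sigma> S"
  proof (rule levy_continuity[OF \<sigma> S])
    fix t
    have "char (\<sigma> n) t = char ((\<mu> \<circ> r) n) t ^ k" for n
      unfolding \<sigma>_def T_def \<mu>_def h_def comp_def by (rule char_uniform_sum[OF V])
    moreover have "(\<lambda>n. char ((\<mu> \<circ> r) n) t) \<longlonglongrightarrow> char (distr M borel unit_clamp) t"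
      by (rule levy_continuity1[OF _ \<nu> conv]) (simp add: \<mu>)
    ultimately show "(\<lambda>n. char (\<sigma> n) t) \<longlonglongrightarrow> char S t"
      by (simp add: charS tendsto_power)
  qed
  moreover have "q k (x (h n)) - 1 / real (Suc (h n)) \<le> measure (\<sigma> n) {1..}" for n
  proof -
    have "card (T n) = card (V (h n)) ^ k" by (simp add: T_def card_PiE)
    then show ?thesis
      unfolding \<sigma>_def uniform_law(2)[OF T] using prob[of "h n"] cV[of "h n"]
      by (simp add: T_def pos_le_divide_eq)
  qed
  moreover have "(\<lambda>n. q k (x (h n)) - 1 / real (Suc (h n))) \<longlonglongrightarrow> q k x0 - 0"
    unfolding q_def by (intro tendsto_intros xh small)
  ultimately have "q k x0 - 0 \<le> measure S {1..}"
    by (rule weak_limit_closed_ray[OF \<sigma> S])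
  then have eq: "measure (distr M borel unit_clamp) {1 / real k..} = x0" using tail by simp
  have "x0 + \<rho> \<le> measure (distr M borel unit_clamp) {1 / real k..}"
  proof (rule weak_limit_closed_ray[OF _ \<nu> conv])
    show "real_distribution ((\<mu> \<circ> r) n)" for n using \<mu> by simp
    show "(\<lambda>n. x (h n) + \<rho>) \<longlonglongrightarrow> x0 + \<rho>" by (intro tendsto_intros xh)
    show "x (h n) + \<rho> \<le> measure ((\<mu> \<circ> r) n) {1 / real k..}" for n
      using many[of "h n"] cV[of "h n"]
      unfolding \<mu>_def comp_def uniform_law(2)[OF V] h_def
      by (simp add: pos_le_divide_eq)
  qed
  with eq \<rho> show False by simp
qed

section \<open>Colourings whose patterns are robust\<close>

definition colour_class :: "('a \<Rightarrow> nat) \<Rightarrow> 'a set \<Rightarrow> nat \<Rightarrow> 'a set" where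
  "colour_class c V i = {v \<in> V. c v = i}"

text \<open>Restricted to the index set, so that there are only finitely many patterns in finitely
  many colours.\<close>
definition pattern :: "nat \<Rightarrow> ('a \<Rightarrow> nat) \<Rightarrow> (nat \<Rightarrow> 'a) \<Rightarrow> nat \<Rightarrow> nat" where
  "pattern k c \<omega> = (\<lambda>j\<in>{1..k}. c (\<omega> j))"

text \<open>\<open>H\<close> is the set of ordered tuples that enumerate edges.  A colour may occur several times in \<open>T\<close>;
  the sets \<open>U j\<close> for these positions may then overlap or coincide.\<close>
definition robust :: "real \<Rightarrow> nat \<Rightarrow> (nat \<Rightarrow> 'a) set \<Rightarrow> ('a \<Rightarrow> nat) \<Rightarrow> 'a set \<Rightarrow> (nat \<Rightarrow> nat) \<Rightarrow> bool" where
  "robust \<epsilon> k H c V T \<longleftrightarrow>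
    (\<forall>U. (\<forall>j\<in>{1..k}. U j \<subseteq> colour_class c V (T j) \<and> \<epsilon> * card (colour_class c V (T j)) \<le> card (U j)) \<longrightarrow>
      H \<inter> PiE {1..k} U \<noteq> {})"

text \<open>The number of these tuples is the potential of the refinement argument: it can only grow when
  colours are split.\<close>
definition edge_free :: "nat \<Rightarrow> (nat \<Rightarrow> 'a) set \<Rightarrow> ('a \<Rightarrow> nat) \<Rightarrow> 'a set \<Rightarrow> (nat \<Rightarrow> 'a) set" where
  "edge_free k H c V = {\<omega> \<in> {1..k} \<rightarrow>\<^sub>E V. \<forall>\<omega>'\<in>H. pattern k c \<omega>' \<noteq> pattern k c \<omega>}"

lemma robustD:
  assumes "robust \<epsilon> k H c V T" "\<And>j. j \<in> {1..k} \<Longrightarrow> U j \<subseteq> colour_class c V (T j)"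
    "\<And>j. j \<in> {1..k} \<Longrightarrow> \<epsilon> * card (colour_class c V (T j)) \<le> card (U j)"
  obtains \<omega> where "\<omega> \<in> H" "\<omega> \<in> PiE {1..k} U"
proof -
  have "H \<inter> PiE {1..k} U \<noteq> {}"
    using assms(1)[unfolded robust_def, rule_format, of U] assms(2,3) by simp
  then show ?thesis using that by blast
qed

lemma pattern_eq_iff: "pattern k c \<omega> = pattern k c \<omega>' \<longleftrightarrow> (\<forall>j\<in>{1..k}. c (\<omega> j) = c (\<omega>' j))"
  by (auto simp: pattern_def fun_eq_iff restrict_def)

lemma pattern_in: "(\<And>v. v \<in> V \<Longrightarrow> c v < K) \<Longrightarrow> \<omega> \<in> {1..k} \<rightarrow>\<^sub>E V \<Longrightarrow> pattern k c \<omega> \<in> {1..k} \<rightarrow>\<^sub>E {..<K}"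
  by (auto simp: pattern_def PiE_iff)

lemma box_pattern:
  assumes "\<omega> \<in> PiE {1..k} U" "T \<in> {1..k} \<rightarrow>\<^sub>E C" "\<And>j. j \<in> {1..k} \<Longrightarrow> U j \<subseteq> colour_class c V (T j)"
  shows "pattern k c \<omega> = T" "\<omega> \<in> {1..k} \<rightarrow>\<^sub>E V"
proof -
  have c: "\<omega> j \<in> colour_class c V (T j)" if "j \<in> {1..k}" for j
    using PiE_mem[OF assms(1) that] assms(3)[OF that] by blast
  show "pattern k c \<omega> = T"
  proof
    fix j show "pattern k c \<omega> j = T j"
      using c[of j] assms(2) by (cases "j \<in> {1..k}") (auto simp: pattern_def colour_class_def PiE_iff extensional_def)
  qed
  show "\<omega> \<in> {1..k} \<rightarrow>\<^sub>E V" using c assms(1) by (auto simp: PiE_iff colour_class_def)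
qed

text \<open>For each non-robust pattern of a member of \<open>H\<close> fix large subsets of its colour classes whose
  box avoids \<open>H\<close>, and split all colours along all these subsets.  The chosen boxes become edge-free.
  They were not edge-free before, because the whole box of such a pattern contains a
  member of \<open>H\<close>; and each of them holds at least an \<open>\<epsilon>\<^sup>k\<close>-fraction of the tuples with its pattern.\<close>
lemma refine_colouring:
  fixes c :: "'a \<Rightarrow> nat" and \<epsilon> \<gamma> :: real
  assumes V: "finite V" and c: "\<And>v. v \<in> V \<Longrightarrow> c v < K" and H: "H \<subseteq> {1..k} \<rightarrow>\<^sub>E V" and \<epsilon>: "0 \<le> \<epsilon>"
    and many: "\<gamma> * card V ^ k < card {\<omega> \<in> H. \<not> robust \<epsilon> k H c V (pattern k c \<omega>)}"
  obtains c' :: "'a \<Rightarrow> nat" where "\<And>v. v \<in> V \<Longrightarrow> c' v < K * 2 ^ (K ^ k * k)"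
    "card (edge_free k H c V) + \<epsilon> ^ k * (\<gamma> * card V ^ k) \<le> card (edge_free k H c' V)"
proof -
  define types where "types = ({1..k} \<rightarrow>\<^sub>E {..<K})"
  define bad where "bad = pattern k c ` {\<omega> \<in> H. \<not> robust \<epsilon> k H c V (pattern k c \<omega>)}"
  have fin_types: "finite types" "card types = K ^ k"
    unfolding types_def by (auto intro: finite_PiE simp: card_PiE)
  have bad_types: "bad \<subseteq> types"
  proof
    fix T assume "T \<in> bad"
    then obtain \<omega> where "\<omega> \<in> H" "T = pattern k c \<omega>" by (auto simp: bad_def)
    then show "T \<in> types" using pattern_in[of V c K \<omega> k] c H by (auto simp: types_def)
  qed
  have fin_bad: "finite bad" using bad_types fin_types finite_subset by blast
  have fin_tuples: "finite ({1..k} \<rightarrow>\<^sub>E V)" using V by (auto intro: finite_PiE)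
  have "\<forall>T\<in>bad. \<exists>U. (\<forall>j\<in>{1..k}. U j \<subseteq> colour_class c V (T j) \<and> \<epsilon> * card (colour_class c V (T j)) \<le> card (U j)) \<and>
      H \<inter> PiE {1..k} U = {}"
  proof
    fix T assume "T \<in> bad"
    then have "\<not> robust \<epsilon> k H c V T" by (auto simp: bad_def)
    then show "\<exists>U. (\<forall>j\<in>{1..k}. U j \<subseteq> colour_class c V (T j) \<and> \<epsilon> * card (colour_class c V (T j)) \<le> card (U j)) \<and>
      H \<inter> PiE {1..k} U = {}"
      unfolding robust_def by blast
  qed
  from bchoice[OF this] obtain U where U0: "\<forall>T\<in>bad. (\<forall>j\<in>{1..k}. U T j \<subseteq> colour_class c V (T j) \<and>
      \<epsilon> * card (colour_class c V (T j)) \<le> card (U T j)) \<and> H \<inter> PiE {1..k} (U T) = {}"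
    by (rule exE)
  have U: "U T j \<subseteq> colour_class c V (T j)" and large: "\<epsilon> * card (colour_class c V (T j)) \<le> card (U T j)"
    if "T \<in> bad" "j \<in> {1..k}" for T j
    using bspec[OF U0 that(1)] that(2) by auto
  have empty: "H \<inter> PiE {1..k} (U T) = {}" if "T \<in> bad" for T
    using bspec[OF U0 that] by (rule conjunct2)
  \<comment> \<open>A new colour records the old colour and, for all patterns \<open>T\<close> and positions \<open>j\<close>, membership in
    \<open>U T j\<close>.  For patterns outside \<open>bad\<close> the sets \<open>U T j\<close> are arbitrary and only refine further.\<close>
  define codes where "codes = {..<K} \<times> Pow (types \<times> {1..k})"
  define g where "g v = (c v, {p \<in> types \<times> {1..k}. v \<in> U (fst p) (snd p)})" for v
  have codes: "finite codes" "card codes = K * 2 ^ (K ^ k * k)"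
    using fin_types by (auto simp: codes_def card_cartesian_product card_Pow)
  have g: "g v \<in> codes" if "v \<in> V" for v using c[OF that] by (auto simp: g_def codes_def)
  obtain h where h: "bij_betw h codes {0..<card codes}" using ex_bij_betw_finite_nat[OF codes(1)] by blast
  define c' where "c' v = h (g v)" for v
  have c'_eq: "g v = g u" if "c' v = c' u" "v \<in> V" "u \<in> V" for v u
    using that h g unfolding c'_def bij_betw_def inj_on_def by blast
  define new where "new = (\<Union>T\<in>bad. PiE {1..k} (U T))"
  have new_pattern: "pattern k c \<omega> = T" "\<omega> \<in> {1..k} \<rightarrow>\<^sub>E V" if "T \<in> bad" "\<omega> \<in> PiE {1..k} (U T)" for \<omega> T
  proof -
    have "T \<in> {1..k} \<rightarrow>\<^sub>E {..<K}" using bad_types that(1) by (auto simp: types_def)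
    note box = box_pattern[OF that(2) this U[OF that(1)]]
    show "pattern k c \<omega> = T" by (rule box)
    show "\<omega> \<in> {1..k} \<rightarrow>\<^sub>E V" by (rule box)
  qed
  have same: "g (\<omega> j) = g (\<omega>' j)"
    if "pattern k c' \<omega> = pattern k c' \<omega>'" "\<omega> \<in> {1..k} \<rightarrow>\<^sub>E V" "\<omega>' \<in> {1..k} \<rightarrow>\<^sub>E V" "j \<in> {1..k}" for \<omega> \<omega>' j
    using that by (intro c'_eq) (auto simp: pattern_eq_iff PiE_iff)
  have old_edge_free: "edge_free k H c V \<subseteq> edge_free k H c' V"
  proof
    fix \<omega> assume \<omega>: "\<omega> \<in> edge_free k H c V"
    have "pattern k c' \<omega>' \<noteq> pattern k c' \<omega>" if "\<omega>' \<in> H" for \<omega>'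
    proof
      assume eq: "pattern k c' \<omega>' = pattern k c' \<omega>"
      have "g (\<omega>' j) = g (\<omega> j)" if "j \<in> {1..k}" for j
        using same[OF eq] \<omega> \<open>\<omega>' \<in> H\<close> H that by (auto simp: edge_free_def)
      then have "pattern k c \<omega>' = pattern k c \<omega>" by (auto simp: pattern_eq_iff g_def)
      then show False using \<omega> that by (auto simp: edge_free_def)
    qed
    then show "\<omega> \<in> edge_free k H c' V" using \<omega> by (auto simp: edge_free_def)
  qed
  have new_edge_free: "new \<subseteq> edge_free k H c' V"
  proof
    fix \<omega> assume "\<omega> \<in> new"
    then obtain T where T: "T \<in> bad" and \<omega>: "\<omega> \<in> PiE {1..k} (U T)" by (auto simp: new_def)
    have \<omega>V: "\<omega> \<in> {1..k} \<rightarrow>\<^sub>E V" by (rule new_pattern[OF T \<omega>])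
    have "pattern k c' \<omega>' \<noteq> pattern k c' \<omega>" if \<omega>': "\<omega>' \<in> H" for \<omega>'
    proof
      assume eq: "pattern k c' \<omega>' = pattern k c' \<omega>"
      have "\<omega>' j \<in> U T j" if j: "j \<in> {1..k}" for j
      proof -
        have "g (\<omega>' j) = g (\<omega> j)" using same[OF eq _ _ j] \<omega>V \<omega>' H by auto
        moreover have "(T, j) \<in> snd (g (\<omega> j))"
          using T bad_types \<omega> j by (auto simp: g_def PiE_iff)
        ultimately have "(T, j) \<in> snd (g (\<omega>' j))" by simp
        then show ?thesis by (simp add: g_def)
      qed
      then have "\<omega>' \<in> PiE {1..k} (U T)" using \<omega>' H by (auto simp: PiE_iff)
      then show False using empty[OF T] \<omega>' by blast
    qed
    then show "\<omega> \<in> edge_free k H c' V" using \<omega>V by (auto simp: edge_free_def)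
  qed
  have disj: "edge_free k H c V \<inter> new = {}"
  proof (rule ccontr)
    assume "edge_free k H c V \<inter> new \<noteq> {}"
    then obtain \<omega> T where "\<omega> \<in> edge_free k H c V" and T: "T \<in> bad" and "\<omega> \<in> PiE {1..k} (U T)"
      by (auto simp: new_def)
    moreover obtain \<omega>' where "\<omega>' \<in> H" "pattern k c \<omega>' = T" using T by (auto simp: bad_def)
    ultimately show False using new_pattern(1)[OF T] by (auto simp: edge_free_def)
  qed
  have fin_new: "finite new" using new_pattern(2) fin_tuples unfolding new_def
    by (intro finite_subset[OF _ fin_tuples]) blast
  have "\<epsilon> ^ k * (\<gamma> * card V ^ k) \<le> \<epsilon> ^ k * card {\<omega> \<in> H. \<not> robust \<epsilon> k H c V (pattern k c \<omega>)}"
    using many \<epsilon> by (intro mult_left_mono) auto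
  also have "card {\<omega> \<in> H. \<not> robust \<epsilon> k H c V (pattern k c \<omega>)}
      \<le> card (\<Union>T\<in>bad. PiE {1..k} (\<lambda>j. colour_class c V (T j)))"
  proof (rule card_mono)
    have "(\<Union>T\<in>bad. PiE {1..k} (\<lambda>j. colour_class c V (T j))) \<subseteq> {1..k} \<rightarrow>\<^sub>E V"
      by (auto simp: PiE_iff colour_class_def)
    then show "finite (\<Union>T\<in>bad. PiE {1..k} (\<lambda>j. colour_class c V (T j)))"
      using fin_tuples finite_subset by blast
    have "\<omega> \<in> PiE {1..k} (\<lambda>j. colour_class c V (pattern k c \<omega> j))" if "\<omega> \<in> H" for \<omega>
      using that H by (auto simp: PiE_iff colour_class_def pattern_def)
    then show "{\<omega> \<in> H. \<not> robust \<epsilon> k H c V (pattern k c \<omega>)} \<subseteq> (\<Union>T\<in>bad. PiE {1..k} (\<lambda>j. colour_class c V (T j)))"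
      by (auto simp: bad_def)
  qed
  then have "\<epsilon> ^ k * card {\<omega> \<in> H. \<not> robust \<epsilon> k H c V (pattern k c \<omega>)}
      \<le> \<epsilon> ^ k * (\<Sum>T\<in>bad. \<Prod>j\<in>{1..k}. real (card (colour_class c V (T j))))"
  proof -
    have "card (\<Union>T\<in>bad. PiE {1..k} (\<lambda>j. colour_class c V (T j))) \<le> (\<Sum>T\<in>bad. card (PiE {1..k} (\<lambda>j. colour_class c V (T j))))"
      by (rule card_UN_le[OF fin_bad])
    also have "\<dots> = (\<Sum>T\<in>bad. \<Prod>j\<in>{1..k}. card (colour_class c V (T j)))"
      by (simp add: card_PiE)
    finally have "card (\<Union>T\<in>bad. PiE {1..k} (\<lambda>j. colour_class c V (T j))) \<le> (\<Sum>T\<in>bad. \<Prod>j\<in>{1..k}. card (colour_class c V (T j)))" .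
    then have "card {\<omega> \<in> H. \<not> robust \<epsilon> k H c V (pattern k c \<omega>)} \<le> (\<Sum>T\<in>bad. \<Prod>j\<in>{1..k}. card (colour_class c V (T j)))"
      using \<open>card {\<omega> \<in> H. _ \<omega>} \<le> _\<close> by linarith
    then have "real (card {\<omega> \<in> H. \<not> robust \<epsilon> k H c V (pattern k c \<omega>)}) \<le> real (\<Sum>T\<in>bad. \<Prod>j\<in>{1..k}. card (colour_class c V (T j)))"
      by (rule of_nat_mono)
    then show ?thesis using \<epsilon> by (intro mult_left_mono) auto
  qed
  also have "\<dots> = (\<Sum>T\<in>bad. \<Prod>j\<in>{1..k}. \<epsilon> * card (colour_class c V (T j)))"
    by (simp add: sum_distrib_left prod.distrib)
  also have "\<dots> \<le> (\<Sum>T\<in>bad. \<Prod>j\<in>{1..k}. real (card (U T j)))"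
    using large \<epsilon> by (intro sum_mono prod_mono) auto
  also have "\<dots> = real (card new)"
  proof -
    have "card new = (\<Sum>T\<in>bad. card (PiE {1..k} (U T)))"
      unfolding new_def
    proof (rule card_UN_disjoint[OF fin_bad])
      show "\<forall>T\<in>bad. finite (PiE {1..k} (U T))"
        using new_pattern(2) fin_tuples by (meson finite_subset subsetI)
      show "\<forall>T\<in>bad. \<forall>T'\<in>bad. T \<noteq> T' \<longrightarrow> PiE {1..k} (U T) \<inter> PiE {1..k} (U T') = {}"
        using new_pattern(1) by blast
    qed
    then show ?thesis by (simp add: card_PiE)
  qed
  finally have grow: "\<epsilon> ^ k * (\<gamma> * card V ^ k) \<le> card new" .
  have "card (edge_free k H c V) + card new = card (edge_free k H c V \<union> new)"
    using disj fin_new fin_tuples by (intro card_Un_disjoint[symmetric]) (auto simp: edge_free_def)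
  also have "\<dots> \<le> card (edge_free k H c' V)"
    using old_edge_free new_edge_free fin_tuples by (intro card_mono) (auto simp: edge_free_def)
  finally have "real (card (edge_free k H c V)) + card new \<le> card (edge_free k H c' V)" by simp
  then have "card (edge_free k H c V) + \<epsilon> ^ k * (\<gamma> * card V ^ k) \<le> card (edge_free k H c' V)" using grow by linarith
  moreover have "c' v < K * 2 ^ (K ^ k * k)" if "v \<in> V" for v
    using bij_betwE[OF h] g[OF that] codes(2) by (auto simp: c'_def)
  ultimately show ?thesis using that by blast
qed

text \<open>Each refinement adds the fixed proportion \<open>\<epsilon>\<^sup>k \<gamma>\<close> of all tuples to the edge-free ones, so it
  can be repeated only a bounded number of times.  The number of colours is bounded in
  terms of the number of steps only.\<close>
lemma robust_colouring:
  fixes \<epsilon> \<gamma> :: real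
  assumes \<epsilon>: "0 < \<epsilon>" and \<gamma>: "0 < \<gamma>"
  obtains K :: nat where "\<And>(V :: 'a set) H. finite V \<Longrightarrow> V \<noteq> {} \<Longrightarrow> H \<subseteq> {1..k} \<rightarrow>\<^sub>E V \<Longrightarrow>
    \<exists>c. (\<forall>v\<in>V. c v < K) \<and> card {\<omega> \<in> H. \<not> robust \<epsilon> k H c V (pattern k c \<omega>)} \<le> \<gamma> * card V ^ k"
proof -
  have step: "\<exists>K. \<forall>(V :: 'a set) H. finite V \<longrightarrow> V \<noteq> {} \<longrightarrow> H \<subseteq> {1..k} \<rightarrow>\<^sub>E V \<longrightarrow>
    (\<exists>c. (\<forall>v\<in>V. c v < K) \<and> (card {\<omega> \<in> H. \<not> robust \<epsilon> k H c V (pattern k c \<omega>)} \<le> \<gamma> * card V ^ k \<or>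
      real m * (\<epsilon> ^ k * (\<gamma> * card V ^ k)) \<le> card (edge_free k H c V)))" for m
  proof (induction m)
    case 0
    show ?case by (intro exI[of _ 1] allI impI exI[of _ "\<lambda>_. 0"]) auto
  next
    case (Suc m)
    then obtain K where K: "\<And>(V :: 'a set) H. finite V \<Longrightarrow> V \<noteq> {} \<Longrightarrow> H \<subseteq> {1..k} \<rightarrow>\<^sub>E V \<Longrightarrow>
      \<exists>c. (\<forall>v\<in>V. c v < K) \<and> (card {\<omega> \<in> H. \<not> robust \<epsilon> k H c V (pattern k c \<omega>)} \<le> \<gamma> * card V ^ k \<or>
      real m * (\<epsilon> ^ k * (\<gamma> * card V ^ k)) \<le> card (edge_free k H c V))" by blast
    let ?K = "K * 2 ^ (K ^ k * k)"
    show ?case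
    proof (intro exI[of _ ?K] allI impI)
      fix V :: "'a set" and H assume V: "finite V" "V \<noteq> {}" and H: "H \<subseteq> {1..k} \<rightarrow>\<^sub>E V"
      obtain c where c: "\<And>v. v \<in> V \<Longrightarrow> c v < K"
        and alt: "card {\<omega> \<in> H. \<not> robust \<epsilon> k H c V (pattern k c \<omega>)} \<le> \<gamma> * card V ^ k \<or>
          real m * (\<epsilon> ^ k * (\<gamma> * card V ^ k)) \<le> card (edge_free k H c V)"
        using K[OF V H] by blast
      show "\<exists>c. (\<forall>v\<in>V. c v < ?K) \<and> (card {\<omega> \<in> H. \<not> robust \<epsilon> k H c V (pattern k c \<omega>)} \<le> \<gamma> * card V ^ k \<or>
        real (Suc m) * (\<epsilon> ^ k * (\<gamma> * card V ^ k)) \<le> card (edge_free k H c V))"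
      proof (cases "card {\<omega> \<in> H. \<not> robust \<epsilon> k H c V (pattern k c \<omega>)} \<le> \<gamma> * card V ^ k")
        case True
        have "K * 1 \<le> ?K" by (intro mult_le_mono2) simp
        then have "c v < ?K" if "v \<in> V" for v using c[OF that] by linarith
        then show ?thesis using True by blast
      next
        case False
        obtain c' where "\<And>v. v \<in> V \<Longrightarrow> c' v < ?K"
          and "card (edge_free k H c V) + \<epsilon> ^ k * (\<gamma> * card V ^ k) \<le> card (edge_free k H c' V)"
        proof (rule refine_colouring[OF V(1) _ H])
          show "\<gamma> * card V ^ k < card {\<omega> \<in> H. \<not> robust \<epsilon> k H c V (pattern k c \<omega>)}"
            using False by simp
        qed (use c \<epsilon> in auto)
        moreover have "real m * (\<epsilon> ^ k * (\<gamma> * card V ^ k)) \<le> card (edge_free k H c V)"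
          using alt False by blast
        ultimately show ?thesis by (intro exI[of _ c']) (auto simp: algebra_simps)
      qed
    qed
  qed
  obtain m where m: "1 < real m * (\<epsilon> ^ k * \<gamma>)"
    using reals_Archimedean3[of "\<epsilon> ^ k * \<gamma>"] \<epsilon> \<gamma> by auto
  from step[of m] obtain K where K: "\<And>(V :: 'a set) H. finite V \<Longrightarrow> V \<noteq> {} \<Longrightarrow> H \<subseteq> {1..k} \<rightarrow>\<^sub>E V \<Longrightarrow>
      \<exists>c. (\<forall>v\<in>V. c v < K) \<and> (card {\<omega> \<in> H. \<not> robust \<epsilon> k H c V (pattern k c \<omega>)} \<le> \<gamma> * card V ^ k \<or>
      real m * (\<epsilon> ^ k * (\<gamma> * card V ^ k)) \<le> card (edge_free k H c V))" by blast
  show ?thesis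
  proof (rule that[of K])
    fix V :: "'a set" and H assume V: "finite V" "V \<noteq> {}" and H: "H \<subseteq> {1..k} \<rightarrow>\<^sub>E V"
    have "\<not> real m * (\<epsilon> ^ k * (\<gamma> * card V ^ k)) \<le> card (edge_free k H c V)" for c
    proof -
      have "card (edge_free k H c V) \<le> card ({1..k} \<rightarrow>\<^sub>E V)"
        using V by (intro card_mono) (auto simp: edge_free_def intro: finite_PiE)
      also have "\<dots> = card V ^ k" by (simp add: card_PiE)
      finally have "real (card (edge_free k H c V)) \<le> 1 * real (card V ^ k)" by simp
      also have "\<dots> < real m * (\<epsilon> ^ k * \<gamma>) * real (card V ^ k)"
        using m V by (intro mult_strict_right_mono) (auto simp: card_gt_0_iff)
      finally show ?thesis by (simp add: mult.assoc)
    qed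
    then show "\<exists>c. (\<forall>v\<in>V. c v < K) \<and> card {\<omega> \<in> H. \<not> robust \<epsilon> k H c V (pattern k c \<omega>)} \<le> \<gamma> * card V ^ k"
      using K[OF V H] by blast
  qed
qed

section \<open>Approximate linear programming duality\<close>

text \<open>The square of the positive part has a 2-Lipschitz derivative; this is its quadratic upper bound,
  which replaces differentiation in the duality argument below.\<close>
lemma square_positive_part_add:
  fixes x h :: real
  shows "(max 0 (x + h))\<^sup>2 \<le> (max 0 x)\<^sup>2 + 2 * h * max 0 x + h\<^sup>2"
proof -
  have "(max 0 (x + h))\<^sup>2 \<le> (max 0 x + h)\<^sup>2"
    by (rule abs_le_square_iff[THEN iffD1]) (auto simp: max_def abs_if)
  then show ?thesis by (simp add: power2_eq_square algebra_simps)
qed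

lemma nonpos_if_le_small_multiples:
  fixes D C t :: real
  assumes t: "t > 0" and le: "\<And>h. 0 < h \<Longrightarrow> h \<le> t \<Longrightarrow> h * D \<le> h\<^sup>2 * C"
  shows "D \<le> 0"
proof (rule ccontr)
  assume D: "\<not> D \<le> 0"
  define h where "h = min t (D / (2 * (\<bar>C\<bar> + 1)))"
  have h: "0 < h" "h \<le> t" using t D by (auto simp: h_def)
  have "D \<le> h * C" using le[OF h] h by (simp add: power2_eq_square)
  also have "\<dots> \<le> h * (\<bar>C\<bar> + 1)" using h by (intro mult_left_mono) auto
  also have "\<dots> \<le> D / (2 * (\<bar>C\<bar> + 1)) * (\<bar>C\<bar> + 1)"
    by (intro mult_right_mono) (auto simp: h_def)
  also have "\<dots> = D / 2" by (simp add: field_simps add_nonneg_eq_0_iff)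
  finally show False using D by simp
qed

text \<open>A penalised maximisation proves the duality theorem up to a factor \<open>1 + \<beta>\<close> without
  any separation theorem.  Maximise the total weight \<open>\<Sum> l\<close> minus \<open>(\<beta>/2) \<Sum> b e\<^sup>2\<close>, where \<open>e i\<close> is
  \<open>1/\<beta>\<close> times the relative excess of the load of \<open>i\<close> over its capacity \<open>b i\<close>.  The derivative with
  respect to \<open>l T\<close> is \<open>1 - \<Sum> A T i * e i\<close>, so at a maximum \<open>e\<close> is a fractional cover, tight at those
  \<open>T\<close> with \<open>l T > 0\<close>.  Tightness bounds \<open>e\<close> by 1, which bounds the loads by \<open>(1 + \<beta>) b\<close>, and gives
  \<open>\<Sum> l = \<Sum> load * e \<ge> \<Sum> b * e\<close> by complementary slackness.\<close>
lemma approximate_lp_duality: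
  fixes A :: "'g \<Rightarrow> 'i \<Rightarrow> nat" and b :: "'i \<Rightarrow> real" and \<beta> :: real
  assumes G: "finite G" and I: "finite I" and b: "\<And>i. i \<in> I \<Longrightarrow> 0 < b i" and \<beta>: "0 < \<beta>"
    and meets: "\<And>T. T \<in> G \<Longrightarrow> \<exists>i\<in>I. 0 < A T i"
  shows "\<exists>(l :: 'g \<Rightarrow> real) (w :: 'i \<Rightarrow> real).
    (\<forall>T\<in>G. 0 \<le> l T) \<and> (\<forall>i\<in>I. w i \<in> {0..1}) \<and>
    (\<forall>T\<in>G. 1 \<le> (\<Sum>i\<in>I. A T i * w i)) \<and>
    (\<forall>i\<in>I. (\<Sum>T\<in>G. l T * A T i) \<le> (1 + \<beta>) * b i) \<and>
    (\<Sum>i\<in>I. b i * w i) \<le> (\<Sum>T\<in>G. l T)"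
proof -
  \<comment> \<open>The bound \<open>L\<close> makes the domain compact and is large enough that a coordinate \<open>l T = L\<close>
    alone brings the load of every \<open>i\<close> with \<open>A T i > 0\<close> to at least \<open>(1 + \<beta>) b i\<close>.\<close>
  define L where "L = (1 + \<beta>) * (\<Sum>i\<in>I. b i) + 1"
  have bL: "(1 + \<beta>) * b i \<le> L" if "i \<in> I" for i
  proof -
    have "b i \<le> (\<Sum>i\<in>I. b i)" using that b I by (intro member_le_sum) (auto intro: less_imp_le)
    then have "(1 + \<beta>) * b i \<le> (1 + \<beta>) * (\<Sum>i\<in>I. b i)" using \<beta> by (intro mult_left_mono) auto
    then show ?thesis by (simp add: L_def)
  qed
  have L: "0 < L" unfolding L_def using b \<beta>
    by (intro add_nonneg_pos mult_nonneg_nonneg sum_nonneg) (auto intro: less_imp_le)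
  define load :: "('g \<Rightarrow> real) \<Rightarrow> 'i \<Rightarrow> real" where "load l i = (\<Sum>T\<in>G. l T * A T i)" for l i
  define e where "e l i = max 0 (load l i / b i - 1) / \<beta>" for l i
  define \<Psi> where "\<Psi> l = (\<Sum>T\<in>G. l T) - \<beta> / 2 * (\<Sum>i\<in>I. b i * (e l i)\<^sup>2)" for l
  define B :: "('g \<Rightarrow> real) set" where "B = PiE UNIV (\<lambda>T. if T \<in> G then {0..L} else {0})"
  have "compactin (product_topology (\<lambda>_. euclidean) UNIV) B"
    unfolding B_def compactin_PiE by (auto simp: compactin_euclidean_iff)
  then have "compact B" by (simp add: euclidean_product_topology)
  moreover have "(\<lambda>_. 0) \<in> B" using L by (auto simp: B_def)
  moreover have "continuous_on B \<Psi>"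
  proof -
    have "continuous_on B (\<lambda>l. load l i)" for i
      unfolding load_def
      by (intro continuous_intros continuous_on_subset[OF continuous_on_product_coordinates]) auto
    then have "continuous_on B (\<lambda>l. e l i)" if "i \<in> I" for i
      unfolding e_def using b[OF that] \<beta> by (intro continuous_intros) auto
    then show ?thesis
      unfolding \<Psi>_def
      by (intro continuous_intros continuous_on_subset[OF continuous_on_product_coordinates]) auto
  qed
  ultimately obtain l where l: "l \<in> B" and opt: "\<And>l'. l' \<in> B \<Longrightarrow> \<Psi> l' \<le> \<Psi> l"
    using continuous_attains_sup[of B \<Psi>] by blast
  have l0: "0 \<le> l T" "l T \<le> L" if "T \<in> G" for T
    using l that by (auto simp: B_def PiE_iff split: if_splits)
  have e0: "0 \<le> e l i" for i using \<beta> by (simp add: e_def)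
  define D where "D T = 1 - (\<Sum>i\<in>I. A T i * e l i)" for T
  \<comment> \<open>Comparison with the point obtained by moving one coordinate by \<open>h\<close> of either sign.\<close>
  have first_order: "h * D T \<le> h\<^sup>2 * (\<Sum>i\<in>I. (real (A T i))\<^sup>2 / (2 * \<beta> * b i))"
    if T: "T \<in> G" and h: "0 \<le> l T + h" "l T + h \<le> L" for T h
  proof -
    define l' where "l' = l(T := l T + h)"
    have box: "l S \<in> (if S \<in> G then {0..L} else {0})" for S
      using PiE_mem[OF l[unfolded B_def], of S] by simp
    have "l' S \<in> (if S \<in> G then {0..L} else {0})" for S
      using T h box[of S] by (auto simp: l'_def)
    then have "l' \<in> B" unfolding B_def by (intro PiE_I) auto
    then have le: "\<Psi> l' \<le> \<Psi> l" by (rule opt)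
    have upd: "(\<Sum>S\<in>G. l' S * c S) = (\<Sum>S\<in>G. l S * c S) + h * c T" for c :: "'g \<Rightarrow> real"
      using G T by (simp add: l'_def sum.remove[of G T] algebra_simps)
    have sum': "(\<Sum>S\<in>G. l' S) = (\<Sum>S\<in>G. l S) + h" using upd[of "\<lambda>_. 1"] by simp
    have sq: "\<beta> / 2 * (b i * (e l' i)\<^sup>2) \<le> \<beta> / 2 * (b i * (e l i)\<^sup>2) + h * (A T i * e l i)
        + h\<^sup>2 * ((real (A T i))\<^sup>2 / (2 * \<beta> * b i))" if i: "i \<in> I" for i
    proof -
      define y where "y = h * A T i / b i"
      define x where "x = load l i / b i - 1"
      have "load l' i / b i - 1 = x + y"
        unfolding load_def x_def y_def by (simp add: upd add_divide_distrib)
      then have e': "\<beta> * e l' i = max 0 (x + y)" and e: "\<beta> * e l i = max 0 x"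
        using \<beta> by (simp_all add: e_def x_def)
      have "(\<beta> * e l' i)\<^sup>2 \<le> (\<beta> * e l i)\<^sup>2 + 2 * y * (\<beta> * e l i) + y\<^sup>2"
        unfolding e e' by (rule square_positive_part_add)
      then have "b i / (2 * \<beta>) * (\<beta> * e l' i)\<^sup>2
        \<le> b i / (2 * \<beta>) * ((\<beta> * e l i)\<^sup>2 + 2 * y * (\<beta> * e l i) + y\<^sup>2)"
        using b[OF i] \<beta> by (intro mult_left_mono) auto
      moreover have "b i / (2 * \<beta>) * (\<beta> * E)\<^sup>2 = \<beta> / 2 * (b i * E\<^sup>2)" for E
        using \<beta> by (simp add: field_simps power2_eq_square)
      moreover have "b i / (2 * \<beta>) * (2 * y * (\<beta> * e l i)) = h * (A T i * e l i)"
        using b[OF i] \<beta> by (simp add: y_def)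
      moreover have "b i / (2 * \<beta>) * y\<^sup>2 = h\<^sup>2 * ((real (A T i))\<^sup>2 / (2 * \<beta> * b i))"
        using b[OF i] \<beta> by (simp add: y_def field_simps power2_eq_square)
      ultimately show ?thesis by (simp only: distrib_left)
    qed
    have "\<beta> / 2 * (\<Sum>i\<in>I. b i * (e l' i)\<^sup>2) \<le> (\<Sum>i\<in>I. \<beta> / 2 * (b i * (e l i)\<^sup>2) + h * (A T i * e l i)
        + h\<^sup>2 * ((real (A T i))\<^sup>2 / (2 * \<beta> * b i)))"
      unfolding sum_distrib_left by (intro sum_mono sq)
    also have "\<dots> = \<beta> / 2 * (\<Sum>i\<in>I. b i * (e l i)\<^sup>2) + h * (\<Sum>i\<in>I. A T i * e l i)
        + h\<^sup>2 * (\<Sum>i\<in>I. (real (A T i))\<^sup>2 / (2 * \<beta> * b i))"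
      by (simp add: sum.distrib sum_distrib_left)
    finally show ?thesis using le unfolding \<Psi>_def sum' D_def by (simp add: algebra_simps)
  qed
  have cover: "1 \<le> (\<Sum>i\<in>I. A T i * e l i)" if T: "T \<in> G" for T
  proof (cases "l T < L")
    case True
    have "D T \<le> 0"
    proof (rule nonpos_if_le_small_multiples)
      show "0 < L - l T" using True by simp
      show "h * D T \<le> h\<^sup>2 * (\<Sum>i\<in>I. (real (A T i))\<^sup>2 / (2 * \<beta> * b i))"
        if "0 < h" "h \<le> L - l T" for h
        using first_order[OF T, of h] l0[OF T] that by simp
    qed
    then show ?thesis by (simp add: D_def)
  next
    case False
    then have lT: "l T = L" using l0[OF T] by simp
    obtain i where i: "i \<in> I" "0 < A T i" using meets[OF T] by blast
    have "L * 1 \<le> l T * A T i" unfolding lT using i L by (intro mult_left_mono) auto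
    also have "\<dots> \<le> load l i"
      unfolding load_def using T G l0 by (intro member_le_sum) auto
    finally have "(1 + \<beta>) * b i \<le> load l i" using bL[OF i(1)] by simp
    then have "\<beta> \<le> load l i / b i - 1" using b[OF i(1)] by (simp add: field_simps)
    then have "1 \<le> e l i" using \<beta> by (simp add: e_def)
    then have "1 * 1 \<le> real (A T i) * e l i" using i by (intro mult_mono) auto
    also have "\<dots> \<le> (\<Sum>i\<in>I. A T i * e l i)"
      using i I e0 by (intro member_le_sum) auto
    finally show ?thesis by simp
  qed
  have slack: "(\<Sum>i\<in>I. A T i * e l i) \<le> 1" if T: "T \<in> G" and pos: "0 < l T" for T
  proof -
    have "- D T \<le> 0"
    proof (rule nonpos_if_le_small_multiples[OF pos])
      fix h assume "0 < h" "h \<le> l T"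
      then show "h * - D T \<le> h\<^sup>2 * (\<Sum>i\<in>I. (real (A T i))\<^sup>2 / (2 * \<beta> * b i))"
        using first_order[OF T, of "- h"] l0[OF T] by simp
    qed
    then show ?thesis by (simp add: D_def)
  qed
  have e1: "e l i \<le> 1" if i: "i \<in> I" for i
  proof (rule ccontr)
    assume gt: "\<not> e l i \<le> 1"
    then have "(\<Sum>T\<in>G. l T * A T i) \<noteq> 0" using \<beta> by (auto simp: e_def load_def)
    then obtain T where T: "T \<in> G" "l T * A T i \<noteq> 0"
      by (rule sum.not_neutral_contains_not_neutral)
    then have "l T \<noteq> 0" "1 \<le> real (A T i)" by auto
    then have "0 < l T" using l0(1)[OF T(1)] by linarith
    have "1 * e l i \<le> A T i * e l i" using \<open>1 \<le> real (A T i)\<close> e0 by (intro mult_right_mono) auto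
    also have "\<dots> \<le> (\<Sum>i\<in>I. A T i * e l i)" using i I e0 by (intro member_le_sum) auto
    also have "\<dots> \<le> 1" by (rule slack[OF T(1) \<open>0 < l T\<close>])
    finally show False using gt by simp
  qed
  show ?thesis
  proof (intro exI[of _ l] exI[of _ "e l"] conjI ballI)
    show "(\<Sum>T\<in>G. l T * A T i) \<le> (1 + \<beta>) * b i" if i: "i \<in> I" for i
    proof -
      have "load l i / b i - 1 \<le> \<beta>" using e1[OF i] \<beta> by (simp add: e_def)
      then show ?thesis using b[OF i] by (simp add: field_simps load_def)
    qed
    have "(\<Sum>i\<in>I. b i * e l i) \<le> (\<Sum>i\<in>I. load l i * e l i)"
    proof (rule sum_mono)
      fix i assume i: "i \<in> I"
      show "b i * e l i \<le> load l i * e l i"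
      proof (cases "e l i = 0")
        case False
        then have "max 0 (load l i / b i - 1) \<noteq> 0" using \<beta> by (auto simp: e_def)
        then have "0 < load l i / b i - 1" by linarith
        then have "b i \<le> load l i" using b[OF i] by (simp add: field_simps)
        then show ?thesis using e0 by (rule mult_right_mono)
      qed simp
    qed
    also have "\<dots> = (\<Sum>i\<in>I. \<Sum>T\<in>G. l T * (A T i * e l i))"
      by (simp add: load_def sum_distrib_right mult.assoc)
    also have "\<dots> = (\<Sum>T\<in>G. l T * (\<Sum>i\<in>I. A T i * e l i))"
      by (subst sum.swap) (simp add: sum_distrib_left)
    also have "\<dots> \<le> (\<Sum>T\<in>G. l T)"
    proof (rule sum_mono)
      fix T assume T: "T \<in> G"
      show "l T * (\<Sum>i\<in>I. A T i * e l i) \<le> l T"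
        using slack[OF T] l0[OF T] by (cases "l T = 0") (auto intro: mult_left_le)
    qed
    finally show "(\<Sum>i\<in>I. b i * e l i) \<le> (\<Sum>T\<in>G. l T)" .
  qed (use l0 e0 e1 cover in auto)
qed

section \<open>Fractional covers from small matching number\<close>

definition colour_count :: "nat \<Rightarrow> (nat \<Rightarrow> nat) \<Rightarrow> nat \<Rightarrow> nat" where
  "colour_count k T i = card {j \<in> {1..k}. T j = i}"

definition edge_tuples :: "nat \<Rightarrow> 'a set \<Rightarrow> 'a set set \<Rightarrow> (nat \<Rightarrow> 'a) set" where
  "edge_tuples k V F = {\<omega> \<in> {1..k} \<rightarrow>\<^sub>E V. \<omega> ` {1..k} \<in> F}"

text \<open>Edges are chosen one at a time, in any order, with the prescribed patterns.  Since the
  demands leave a reserve of \<open>\<epsilon> |V\<^sub>i|\<close> in each colour class \<open>V\<^sub>i\<close>, the unused parts of the classes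
  are always large enough for robustness to supply the next edge, which is then disjoint
  from all previous ones.\<close>
lemma greedy_matching_along_patterns:
  fixes V :: "'a set" and \<tau> :: "'p \<Rightarrow> nat \<Rightarrow> nat" and \<epsilon> :: real
  assumes V: "finite V" and k: "k \<ge> 1" and J: "finite J"
    and robust: "\<And>p. p \<in> J \<Longrightarrow> robust \<epsilon> k (edge_tuples k V F) c V (\<tau> p)"
    and capacity: "\<And>i. (\<Sum>p\<in>J. colour_count k (\<tau> p) i) \<le> (1 - \<epsilon>) * card (colour_class c V i)"
  shows "\<exists>M\<subseteq>F. finite M \<and> disjoint M \<and> card M = card J \<and> \<Union>M \<subseteq> V \<and> {} \<notin> M \<and>
    (\<forall>i. card (colour_class c V i \<inter> \<Union>M) \<le> (\<Sum>p\<in>J. colour_count k (\<tau> p) i))"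
  using J robust capacity
proof (induction J rule: finite_induct)
  case empty
  show ?case by (intro exI[of _ "{}"]) auto
next
  case (insert p J)
  have cap: "(\<Sum>p\<in>J. colour_count k (\<tau> p) i) \<le> (1 - \<epsilon>) * card (colour_class c V i)" for i
  proof -
    have "(\<Sum>p\<in>J. colour_count k (\<tau> p) i) \<le> (\<Sum>p\<in>insert p J. colour_count k (\<tau> p) i)"
      using insert.hyps by (intro sum_mono2) auto
    then have "real (\<Sum>p\<in>J. colour_count k (\<tau> p) i) \<le> real (\<Sum>p\<in>insert p J. colour_count k (\<tau> p) i)"
      by (rule of_nat_mono)
    then show ?thesis using insert.prems(2)[of i] by linarith
  qed
  obtain M where M: "M \<subseteq> F" "finite M" "disjoint M" "card M = card J" "\<Union>M \<subseteq> V" "{} \<notin> M"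
    and used: "\<And>i. card (colour_class c V i \<inter> \<Union>M) \<le> (\<Sum>p\<in>J. colour_count k (\<tau> p) i)"
    using insert.IH[OF insert.prems(1) cap] by auto
  define U where "U j = colour_class c V (\<tau> p j) - \<Union>M" for j
  have finc: "finite (colour_class c V i)" for i using V by (simp add: colour_class_def)
  have big: "\<epsilon> * card (colour_class c V (\<tau> p j)) \<le> card (U j)" if "j \<in> {1..k}" for j
  proof -
    have "card (U j) + card (colour_class c V (\<tau> p j) \<inter> \<Union>M) = card (colour_class c V (\<tau> p j))"
      unfolding U_def using finc by (subst card_Un_disjoint[symmetric]) (auto intro!: arg_cong[where f = card])
    moreover have "real (card (colour_class c V (\<tau> p j) \<inter> \<Union>M)) \<le> (1 - \<epsilon>) * card (colour_class c V (\<tau> p j))"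
      using used[of "\<tau> p j"] cap[of "\<tau> p j"] by linarith
    ultimately show ?thesis by (simp add: algebra_simps flip: of_nat_add)
  qed
  have sub: "U j \<subseteq> colour_class c V (\<tau> p j)" if "j \<in> {1..k}" for j by (auto simp: U_def)
  obtain \<omega> where \<omega>H: "\<omega> \<in> edge_tuples k V F" and \<omega>U: "\<omega> \<in> PiE {1..k} U"
    by (rule robustD[OF insert.prems(1)[OF insertI1] sub big])
  then have \<omega>: "\<omega> \<in> {1..k} \<rightarrow>\<^sub>E V" "\<omega> ` {1..k} \<in> F" by (auto simp: edge_tuples_def)
  define E where "E = \<omega> ` {1..k}"
  have EU: "\<omega> j \<in> colour_class c V (\<tau> p j)" "\<omega> j \<notin> \<Union>M" if "j \<in> {1..k}" for j
    using PiE_mem[OF \<omega>U that] by (auto simp: U_def)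
  have E: "E \<in> F" "E \<noteq> {}" "E \<inter> \<Union>M = {}" "E \<subseteq> V"
    using \<omega> k EU by (auto simp: E_def colour_class_def)
  have "E \<notin> M" using E by blast
  show ?case
  proof (intro exI[of _ "insert E M"] conjI allI)
    show "insert E M \<subseteq> F" "finite (insert E M)" "\<Union>(insert E M) \<subseteq> V" "{} \<notin> insert E M"
      using M E by auto
    show "disjoint (insert E M)"
      using M(3) E(3) unfolding disjoint_def by blast
    show "card (insert E M) = card (insert p J)" using M \<open>E \<notin> M\<close> insert.hyps by simp
    fix i
    have "card (colour_class c V i \<inter> E) \<le> card (\<omega> ` {j \<in> {1..k}. \<tau> p j = i})"
      using EU(1) by (intro card_mono) (auto simp: E_def colour_class_def)
    also have "\<dots> \<le> colour_count k (\<tau> p) i"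
      unfolding colour_count_def by (intro card_image_le) simp
    finally have "card (colour_class c V i \<inter> E) \<le> colour_count k (\<tau> p) i" .
    moreover have "card (colour_class c V i \<inter> \<Union>(insert E M)) \<le> card (colour_class c V i \<inter> E) + card (colour_class c V i \<inter> \<Union>M)"
      using card_Un_le[of "colour_class c V i \<inter> E" "colour_class c V i \<inter> \<Union>M"] by (simp add: Int_Un_distrib)
    ultimately show "card (colour_class c V i \<inter> \<Union>(insert E M)) \<le> (\<Sum>p\<in>insert p J. colour_count k (\<tau> p) i)"
      using used[of i] insert.hyps by simp
  qed
qed

lemma card_le_matching_number:
  assumes "finite F" "M \<subseteq> F" "disjoint M"
  shows "card M \<le> matching_number F"
proof -
  have "finite {M. M \<subseteq> F \<and> disjoint M}"
    by (rule finite_subset[of _ "Pow F"]) (use assms in auto)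
  then show ?thesis unfolding matching_number_def using assms by (intro Max_ge) auto
qed

lemma sum_colour_count:
  fixes w :: "nat \<Rightarrow> real"
  assumes "finite I" "\<And>j. j \<in> {1..k} \<Longrightarrow> T j \<in> I"
  shows "(\<Sum>i\<in>I. colour_count k T i * w i) = (\<Sum>j\<in>{1..k}. w (T j))"
proof -
  have "(\<Sum>j\<in>{1..k}. w (T j)) = (\<Sum>i\<in>I. \<Sum>j\<in>{j \<in> {1..k}. T j = i}. w (T j))"
    by (rule sum.group[symmetric]) (use assms in auto)
  also have "\<dots> = (\<Sum>i\<in>I. colour_count k T i * w i)"
    by (intro sum.cong refl) (simp add: colour_count_def)
  finally show ?thesis ..
qed

text \<open>The linear program has the robust patterns as columns and the colours as rows.  A fractional
  matching of patterns, rounded down to integers, is realised by an actual matching; rounding loses at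
  most 1 for each of the at most \<open>K\<^sup>k\<close> patterns.\<close>
lemma robust_fractional_cover:
  fixes V :: "'a set" and \<epsilon> :: real
  assumes V: "finite V" and k: "k \<ge> 1" and F: "finite F" and c: "\<And>v. v \<in> V \<Longrightarrow> c v < K"
    and \<epsilon>: "0 < \<epsilon>" "\<epsilon> \<le> 1 / 2" and s: "matching_number F \<le> s"
  shows "\<exists>w :: nat \<Rightarrow> real. (\<forall>v\<in>V. w (c v) \<in> {0..1}) \<and>
    (\<forall>\<omega>\<in>{1..k} \<rightarrow>\<^sub>E V. robust \<epsilon> k (edge_tuples k V F) c V (pattern k c \<omega>) \<longrightarrow>
      1 \<le> (\<Sum>j\<in>{1..k}. w (c (\<omega> j)))) \<and>
    (\<Sum>v\<in>V. w (c v)) \<le> (1 + 4 * \<epsilon>) * (s + K ^ k)"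
proof -
  let ?H = "edge_tuples k V F"
  define G where "G = {T \<in> {1..k} \<rightarrow>\<^sub>E {..<K}. robust \<epsilon> k ?H c V T}"
  define I where "I = c ` V"
  \<comment> \<open>Duality overshoots capacities by the factor \<open>1 + \<epsilon>\<close>; the numerator leaves the
    reserve needed by the greedy choice.\<close>
  define b where "b i = (1 - \<epsilon>) / (1 + \<epsilon>) * card (colour_class c V i)" for i
  have finG: "finite G" unfolding G_def
    by (rule finite_subset[of _ "{1..k} \<rightarrow>\<^sub>E {..<K}"]) (auto intro: finite_PiE)
  have "card G \<le> card ({1..k} \<rightarrow>\<^sub>E {..<K})" unfolding G_def by (intro card_mono finite_PiE) auto
  then have cardG: "card G \<le> K ^ k" by (simp add: card_PiE)
  have finI: "finite I" using V by (simp add: I_def)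
  have finc: "finite (colour_class c V i)" for i using V by (simp add: colour_class_def)
  have inI: "T j \<in> I" if T: "T \<in> G" and j: "j \<in> {1..k}" for T j
  proof -
    have "\<epsilon> * card (colour_class c V (T j)) \<le> card (colour_class c V (T j))" for j
      using \<epsilon> by (intro mult_left_le_one_le) auto
    moreover have "robust \<epsilon> k ?H c V T" using T by (simp add: G_def)
    ultimately obtain \<omega> where "\<omega> \<in> PiE {1..k} (\<lambda>j. colour_class c V (T j))"
      using robustD[of \<epsilon> k ?H c V T "\<lambda>j. colour_class c V (T j)"] by blast
    from PiE_mem[OF this j] have "\<omega> j \<in> V" "T j = c (\<omega> j)" by (auto simp: colour_class_def)
    then show ?thesis unfolding I_def by (intro image_eqI)
  qed
  have b: "0 < b i" if i: "i \<in> I" for i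
  proof -
    have "colour_class c V i \<noteq> {}" using i by (auto simp: I_def colour_class_def)
    then show ?thesis using \<epsilon> finc by (simp add: b_def card_gt_0_iff)
  qed
  have meets: "\<exists>i\<in>I. 0 < colour_count k T i" if T: "T \<in> G" for T
  proof
    show "T 1 \<in> I" using inI[OF T] k by simp
    have "1 \<in> {j \<in> {1..k}. T j = T 1}" using k by simp
    then have "{j \<in> {1..k}. T j = T 1} \<noteq> {}" by blast
    then show "0 < colour_count k T (T 1)"
      unfolding colour_count_def by (subst card_gt_0_iff) simp
  qed
  obtain l :: "(nat \<Rightarrow> nat) \<Rightarrow> real" and w :: "nat \<Rightarrow> real"
    where l: "\<And>T. T \<in> G \<Longrightarrow> 0 \<le> l T" and w: "\<And>i. i \<in> I \<Longrightarrow> w i \<in> {0..1}"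
    and cover: "\<And>T. T \<in> G \<Longrightarrow> 1 \<le> (\<Sum>i\<in>I. colour_count k T i * w i)"
    and load: "\<And>i. i \<in> I \<Longrightarrow> (\<Sum>T\<in>G. l T * colour_count k T i) \<le> (1 + \<epsilon>) * b i"
    and dual: "(\<Sum>i\<in>I. b i * w i) \<le> (\<Sum>T\<in>G. l T)"
    using approximate_lp_duality[where A = "colour_count k" and b = b, OF finG finI b \<epsilon>(1) meets]
    by blast
  \<comment> \<open>\<open>J\<close> contains \<open>\<lfloor>l T\<rfloor>\<close> copies of each pattern \<open>T\<close>.\<close>
  define J where "J = (SIGMA T:G. {..<nat \<lfloor>l T\<rfloor>})"
  have finJ: "finite J" using finG by (auto simp: J_def)
  have sumJ: "(\<Sum>p\<in>J. h (fst p)) = (\<Sum>T\<in>G. nat \<lfloor>l T\<rfloor> * h T)" for h :: "(nat \<Rightarrow> nat) \<Rightarrow> nat"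
  proof -
    have "(\<Sum>p\<in>J. h (fst p)) = (\<Sum>(T, x)\<in>J. h T)" by (simp add: case_prod_beta)
    also have "\<dots> = (\<Sum>T\<in>G. \<Sum>x<nat \<lfloor>l T\<rfloor>. h T)"
      unfolding J_def by (rule sum.Sigma[symmetric]) (use finG in auto)
    finally show ?thesis by simp
  qed
  have capacity: "real (\<Sum>p\<in>J. colour_count k (fst p) i) \<le> (1 - \<epsilon>) * card (colour_class c V i)" for i
  proof (cases "i \<in> I")
    case True
    have "real (\<Sum>p\<in>J. colour_count k (fst p) i) = (\<Sum>T\<in>G. real (nat \<lfloor>l T\<rfloor>) * colour_count k T i)"
      using arg_cong[OF sumJ[of "\<lambda>T. colour_count k T i"], of real] by simp
    also have "\<dots> \<le> (\<Sum>T\<in>G. l T * colour_count k T i)"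
      using l by (intro sum_mono mult_right_mono) auto
    also have "\<dots> \<le> (1 + \<epsilon>) * b i" by (rule load[OF True])
    also have "\<dots> = (1 - \<epsilon>) * card (colour_class c V i)" using \<epsilon> by (simp add: b_def)
    finally show ?thesis .
  next
    case False
    have "colour_count k (fst p) i = 0" if "p \<in> J" for p
    proof -
      have "{j \<in> {1..k}. fst p j = i} = {}" using inI[of "fst p"] that False by (auto simp: J_def)
      then show ?thesis by (simp add: colour_count_def)
    qed
    then show ?thesis using \<epsilon> by simp
  qed
  have "\<exists>M\<subseteq>F. finite M \<and> disjoint M \<and> card M = card J \<and> \<Union>M \<subseteq> V \<and> {} \<notin> M \<and>
    (\<forall>i. card (colour_class c V i \<inter> \<Union>M) \<le> (\<Sum>p\<in>J. colour_count k (fst p) i))"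
    by (rule greedy_matching_along_patterns[OF V k finJ _ capacity]) (auto simp: J_def G_def)
  then obtain M where "M \<subseteq> F" "disjoint M" "card M = card J" by blast
  then have "card J \<le> s" using card_le_matching_number[OF F, of M] s by simp
  moreover have "card J = (\<Sum>T\<in>G. nat \<lfloor>l T\<rfloor>)" using sumJ[of "\<lambda>_. 1"] by simp
  ultimately have sJ: "(\<Sum>T\<in>G. real (nat \<lfloor>l T\<rfloor>)) \<le> s" by (simp flip: of_nat_sum)
  have "(\<Sum>T\<in>G. l T) \<le> (\<Sum>T\<in>G. real (nat \<lfloor>l T\<rfloor>) + 1)"
    by (intro sum_mono) linarith
  also have "\<dots> \<le> s + K ^ k"
    using sJ cardG by (simp add: sum.distrib) (metis add_mono of_nat_le_iff of_nat_power)
  finally have sl: "(\<Sum>T\<in>G. l T) \<le> s + K ^ k" .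
  have "(1 - \<epsilon>) / (1 + \<epsilon>) * (\<Sum>v\<in>V. w (c v)) = (\<Sum>i\<in>I. b i * w i)"
  proof -
    have "(\<Sum>v\<in>V. w (c v)) = (\<Sum>i\<in>I. \<Sum>v\<in>{v \<in> V. c v = i}. w (c v))"
      by (rule sum.group[symmetric]) (use V finI in \<open>auto simp: I_def\<close>)
    also have "\<dots> = (\<Sum>i\<in>I. card (colour_class c V i) * w i)"
      by (intro sum.cong refl) (simp add: colour_class_def)
    finally show ?thesis by (simp add: b_def sum_distrib_left mult.assoc)
  qed
  then have "(1 - \<epsilon>) / (1 + \<epsilon>) * (\<Sum>v\<in>V. w (c v)) \<le> s + K ^ k" using dual sl by simp
  then have "(\<Sum>v\<in>V. w (c v)) \<le> (1 + \<epsilon>) / (1 - \<epsilon>) * (s + K ^ k)"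
    using \<epsilon> by (simp add: field_simps)
  also have "\<dots> \<le> (1 + 4 * \<epsilon>) * (s + K ^ k)"
  proof (rule mult_right_mono)
    have "0 \<le> \<epsilon> * (1 - 2 * \<epsilon>)" using \<epsilon> by (intro mult_nonneg_nonneg) auto
    then show "(1 + \<epsilon>) / (1 - \<epsilon>) \<le> 1 + 4 * \<epsilon>" using \<epsilon> by (simp add: field_simps)
  qed simp
  finally have total: "(\<Sum>v\<in>V. w (c v)) \<le> (1 + 4 * \<epsilon>) * (s + K ^ k)" .
  show ?thesis
  proof (intro exI[of _ w] conjI ballI impI)
    show "w (c v) \<in> {0..1}" if "v \<in> V" for v using w[of "c v"] that by (simp add: I_def)
    fix \<omega> assume \<omega>: "\<omega> \<in> {1..k} \<rightarrow>\<^sub>E V" and rob: "robust \<epsilon> k ?H c V (pattern k c \<omega>)"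
    have T: "pattern k c \<omega> \<in> G" unfolding G_def using rob pattern_in[of V c K] c \<omega> by blast
    have "1 \<le> (\<Sum>j\<in>{1..k}. w (pattern k c \<omega> j))"
      using cover[OF T] sum_colour_count[OF finI inI[OF T]] by simp
    also have "\<dots> = (\<Sum>j\<in>{1..k}. w (c (\<omega> j)))"
      by (intro sum.cong refl) (simp add: pattern_def)
    finally show "1 \<le> (\<Sum>j\<in>{1..k}. w (c (\<omega> j)))" .
  qed (rule total)
qed

lemma enumerate_k_set:
  assumes E: "E \<in> [V]\<^bsup>k\<^esup>"
  obtains \<omega> where "\<omega> \<in> {1..k} \<rightarrow>\<^sub>E V" "\<omega> ` {1..k} = E"
proof -
  have "finite E" "card E = k" "E \<subseteq> V" using E by (auto simp: nsets_def)
  then obtain h where "bij_betw h {1..k} E" using ex_bij_betw_nat_finite_1 by blast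
  then have h: "h ` {1..k} = E" by (simp add: bij_betw_def)
  show ?thesis
  proof (rule that[of "restrict h {1..k}"])
    show "restrict h {1..k} \<in> {1..k} \<rightarrow>\<^sub>E V" using h \<open>E \<subseteq> V\<close> by auto
    have "restrict h {1..k} ` {1..k} = h ` {1..k}" by (intro image_cong) auto
    then show "restrict h {1..k} ` {1..k} = E" using h by simp
  qed
qed

lemma sum_enumeration:
  fixes W :: "'a \<Rightarrow> real"
  assumes "\<omega> ` {1..k} \<in> [V]\<^bsup>k\<^esup>"
  shows "(\<Sum>j\<in>{1..k}. W (\<omega> j)) = sum W (\<omega> ` {1..k})"
proof -
  have "card (\<omega> ` {1..k}) = card {1..k}" using assms by (simp add: nsets_def)
  then have "inj_on \<omega> {1..k}" by (intro eq_card_imp_inj_on) auto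
  then show ?thesis by (simp add: sum.reindex)
qed

text \<open>An edge is covered as soon as one of its enumerations has a robust pattern.  Hence distinct
  uncovered edges yield distinct enumerations with non-robust patterns, and these are few.  The
  constant \<open>C\<close> absorbs the rounding loss.\<close>
lemma fractional_cover_of_almost_all:
  fixes \<delta> \<gamma> :: real
  assumes k: "k \<ge> 1" and \<delta>: "0 < \<delta>" and \<gamma>: "0 < \<gamma>"
  obtains C :: real where "\<And>(V :: 'a set) F s. \<lbrakk>finite V; V \<noteq> {}; F \<subseteq> [V]\<^bsup>k\<^esup>; matching_number F \<le> s; s \<le> card V\<rbrakk> \<Longrightarrow>
    \<exists>W :: 'a \<Rightarrow> real. (\<forall>v\<in>V. W v \<in> {0..1}) \<and> sum W V \<le> s + \<delta> * card V + C \<and>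
      card {E \<in> F. sum W E < 1} \<le> \<gamma> * card V ^ k"
proof -
  define \<epsilon> where "\<epsilon> = min (1 / 2) (\<delta> / 4)"
  have \<epsilon>: "0 < \<epsilon>" "\<epsilon> \<le> 1 / 2" "4 * \<epsilon> \<le> \<delta>" using \<delta> by (auto simp: \<epsilon>_def)
  obtain K :: nat where K: "\<And>(V :: 'a set) H. finite V \<Longrightarrow> V \<noteq> {} \<Longrightarrow> H \<subseteq> {1..k} \<rightarrow>\<^sub>E V \<Longrightarrow>
    \<exists>c. (\<forall>v\<in>V. c v < K) \<and> card {\<omega> \<in> H. \<not> robust \<epsilon> k H c V (pattern k c \<omega>)} \<le> \<gamma> * card V ^ k"
    by (rule robust_colouring[OF \<epsilon>(1) \<gamma>, where k = k]) (rule that, blast)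
  show ?thesis
  proof (rule that[of "3 * real (K ^ k)"])
    fix V :: "'a set" and F s
    assume V: "finite V" "V \<noteq> {}" and F: "F \<subseteq> [V]\<^bsup>k\<^esup>" and \<nu>: "matching_number F \<le> s" and s: "s \<le> card V"
    let ?H = "edge_tuples k V F"
    have H: "?H \<subseteq> {1..k} \<rightarrow>\<^sub>E V" by (auto simp: edge_tuples_def)
    have finF: "finite F" using F finite_imp_finite_nsets[OF V(1)] finite_subset by blast
    obtain c where c: "\<And>v. v \<in> V \<Longrightarrow> c v < K"
      and few: "card {\<omega> \<in> ?H. \<not> robust \<epsilon> k ?H c V (pattern k c \<omega>)} \<le> \<gamma> * card V ^ k"
      using K[OF V H] by blast
    obtain w :: "nat \<Rightarrow> real" where w: "\<And>v. v \<in> V \<Longrightarrow> w (c v) \<in> {0..1}"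
      and cover: "\<And>\<omega>. \<omega> \<in> {1..k} \<rightarrow>\<^sub>E V \<Longrightarrow> robust \<epsilon> k ?H c V (pattern k c \<omega>) \<Longrightarrow>
        1 \<le> (\<Sum>j\<in>{1..k}. w (c (\<omega> j)))"
      and total: "(\<Sum>v\<in>V. w (c v)) \<le> (1 + 4 * \<epsilon>) * (s + K ^ k)"
      using robust_fractional_cover[where c = c, OF V(1) k finF c \<epsilon>(1,2) \<nu>] by blast
    let ?W = "\<lambda>v. w (c v)"
    let ?bad = "{\<omega> \<in> ?H. \<not> robust \<epsilon> k ?H c V (pattern k c \<omega>)}"
    have "finite ({1..k} \<rightarrow>\<^sub>E V)" using V by (auto intro: finite_PiE)
    then have "finite ?bad" by (rule rev_finite_subset) (use H in blast)
    moreover have "{E \<in> F. sum ?W E < 1} \<subseteq> (\<lambda>\<omega>. \<omega> ` {1..k}) ` ?bad"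
    proof
      fix E assume E: "E \<in> {E \<in> F. sum ?W E < 1}"
      then obtain \<omega> where \<omega>: "\<omega> \<in> {1..k} \<rightarrow>\<^sub>E V" "\<omega> ` {1..k} = E"
        using enumerate_k_set[of E V k] F by blast
      have "(\<Sum>j\<in>{1..k}. w (c (\<omega> j))) = sum ?W E"
        using sum_enumeration[of \<omega> k V ?W] \<omega> E F by blast
      then have "\<not> robust \<epsilon> k ?H c V (pattern k c \<omega>)" using cover[OF \<omega>(1)] E by fastforce
      then have "\<omega> \<in> ?bad" using \<omega> E by (simp add: edge_tuples_def)
      then show "E \<in> (\<lambda>\<omega>. \<omega> ` {1..k}) ` ?bad" using \<omega>(2) by blast
    qed
    ultimately have "card {E \<in> F. sum ?W E < 1} \<le> card ?bad" by (rule surj_card_le)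
    then have "card {E \<in> F. sum ?W E < 1} \<le> \<gamma> * card V ^ k" using few by linarith
    moreover have "sum ?W V \<le> s + \<delta> * card V + 3 * real (K ^ k)"
    proof -
      have "4 * \<epsilon> * s \<le> \<delta> * card V" using \<epsilon> s by (intro mult_mono) auto
      moreover have "4 * \<epsilon> * real (K ^ k) \<le> 2 * real (K ^ k)" using \<epsilon> by (intro mult_right_mono) auto
      ultimately show ?thesis using total by (simp add: algebra_simps)
    qed
    ultimately show "\<exists>W :: 'a \<Rightarrow> real. (\<forall>v\<in>V. W v \<in> {0..1}) \<and> sum W V \<le> s + \<delta> * card V + 3 * real (K ^ k) \<and>
      card {E \<in> F. sum W E < 1} \<le> \<gamma> * card V ^ k"
      using w by (intro exI[of _ ?W]) auto
  qed
qed

section \<open>Counting k-sets and their enumerations\<close>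

lemma card_enumerations_ge:
  assumes V: "finite V" and F: "F \<subseteq> [V]\<^bsup>k\<^esup>"
  shows "fact k * card F \<le> card (edge_tuples k V F)"
proof -
  define orders where "orders E = {\<omega> \<in> {1..k} \<rightarrow>\<^sub>E E. inj_on \<omega> {1..k}}" for E :: "'a set"
  have finF: "finite F" using F finite_imp_finite_nsets[OF V] finite_subset by blast
  have E: "finite E" "card E = k" "E \<subseteq> V" if "E \<in> F" for E using F that by (auto simp: nsets_def)
  have img: "\<omega> ` {1..k} = E" if "\<omega> \<in> orders E" "E \<in> F" for \<omega> E
  proof (rule card_subset_eq[OF E(1)[OF that(2)]])
    show "\<omega> ` {1..k} \<subseteq> E" using that by (auto simp: orders_def)
    show "card (\<omega> ` {1..k}) = card E" using that E(2) by (simp add: orders_def card_image)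
  qed
  have card_orders: "card (orders E) = fact k" if "E \<in> F" for E
    using card_inj_on_subset_funcset[of "{1..k}" E "{1..k}"] E[OF that]
    by (simp add: orders_def fact_prod_rev)
  have fin: "finite (orders E)" if "E \<in> F" for E
    using card_orders[OF that] by (intro card_ge_0_finite) simp
  have "fact k * card F = (\<Sum>E\<in>F. card (orders E))" using card_orders by simp
  also have "\<dots> = card (\<Union>E\<in>F. orders E)"
    by (rule card_UN_disjoint[symmetric]) (use finF fin img in blast)+
  also have "\<dots> \<le> card (edge_tuples k V F)"
  proof (rule card_mono)
    have "finite ({1..k} \<rightarrow>\<^sub>E V)" using V by (intro finite_PiE) auto
    then show "finite (edge_tuples k V F)" by (simp add: edge_tuples_def)
    show "(\<Union>E\<in>F. orders E) \<subseteq> edge_tuples k V F"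
    proof
      fix \<omega> assume "\<omega> \<in> (\<Union>E\<in>F. orders E)"
      then obtain E' where E': "E' \<in> F" "\<omega> \<in> orders E'" by blast
      then have "\<omega> \<in> {1..k} \<rightarrow>\<^sub>E V" using E(3)[OF E'(1)] by (auto simp: orders_def PiE_iff)
      then show "\<omega> \<in> edge_tuples k V F" using img[OF E'(2,1)] E'(1) by (simp add: edge_tuples_def)
    qed
  qed
  finally show ?thesis .
qed

lemma card_meeting_sets_le:
  assumes V: "finite V" and B: "finite B" and k: "k \<ge> 1"
  shows "card {E \<in> [V]\<^bsup>k\<^esup>. E \<inter> B \<noteq> {}} \<le> card B * card V ^ (k - 1)"
proof -
  have one: "card {E \<in> [V]\<^bsup>k\<^esup>. b \<in> E} \<le> card V ^ (k - 1)" for b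
  proof -
    have fin: "finite (nsets V (k - 1))" by (rule finite_imp_finite_nsets[OF V])
    have "{E \<in> [V]\<^bsup>k\<^esup>. b \<in> E} \<subseteq> insert b ` nsets V (k - 1)"
    proof
      fix E assume E: "E \<in> {E \<in> [V]\<^bsup>k\<^esup>. b \<in> E}"
      then have "E - {b} \<in> nsets V (k - 1)" by (auto simp: nsets_def)
      moreover have "E = insert b (E - {b})" using E by auto
      ultimately show "E \<in> insert b ` nsets V (k - 1)" by (rule rev_image_eqI)
    qed
    then have "card {E \<in> [V]\<^bsup>k\<^esup>. b \<in> E} \<le> card (nsets V (k - 1))" by (rule surj_card_le[OF fin])
    also have "\<dots> = card V choose (k - 1)" by (rule card_nsets)
    also have "\<dots> \<le> (card V choose (k - 1)) * fact (k - 1)" by simp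
    also have "\<dots> \<le> card V ^ (k - 1)" by (rule binomial_fact_pow)
    finally show ?thesis .
  qed
  have fin: "finite (\<Union>b\<in>B. {E \<in> [V]\<^bsup>k\<^esup>. b \<in> E})"
    using B finite_imp_finite_nsets[OF V] by auto
  have "card {E \<in> [V]\<^bsup>k\<^esup>. E \<inter> B \<noteq> {}} \<le> card (\<Union>b\<in>B. {E \<in> [V]\<^bsup>k\<^esup>. b \<in> E})"
    by (rule card_mono[OF fin]) auto
  also have "\<dots> \<le> (\<Sum>b\<in>B. card {E \<in> [V]\<^bsup>k\<^esup>. b \<in> E})" by (rule card_UN_le[OF B])
  also have "\<dots> \<le> (\<Sum>b\<in>B. card V ^ (k - 1))" by (intro sum_mono one)
  finally show ?thesis by simp
qed

lemma card_meeting_family: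
  assumes S: "S \<in> [{1..n}]\<^bsup>s\<^esup>"
  shows "real (card (meeting_family k n S)) = M_bound k n s"
proof -
  have fin: "finite ([{1..n}]\<^bsup>k\<^esup>)" by (rule finite_imp_finite_nsets) simp
  have "[{1..n} - S]\<^bsup>k\<^esup> \<subseteq> [{1..n}]\<^bsup>k\<^esup>" by (rule nsets_mono) auto
  moreover have "meeting_family k n S = [{1..n}]\<^bsup>k\<^esup> - [{1..n} - S]\<^bsup>k\<^esup>"
    by (auto simp: meeting_family_def nsets_def)
  ultimately have "card (meeting_family k n S) = card ([{1..n}]\<^bsup>k\<^esup>) - card ([{1..n} - S]\<^bsup>k\<^esup>)"
    and "card ([{1..n} - S]\<^bsup>k\<^esup>) \<le> card ([{1..n}]\<^bsup>k\<^esup>)"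
    using fin finite_subset by (metis card_Diff_subset, metis card_mono)
  moreover have "card ({1..n} - S) = n - s" using S by (subst card_Diff_subset) (auto simp: nsets_def)
  ultimately show ?thesis by (simp add: M_bound_def card_nsets of_nat_diff)
qed

text \<open>Up to lower order terms, \<open>k! M\<^sub>k(n,s)\<close> counts the tuples that meet a fixed set of size \<open>s\<close>, that is
  \<open>n\<^sup>k - (n - s)\<^sup>k = q\<^sub>k(s/n) n\<^sup>k\<close>.  The error comes from tuples with repeated entries and
  is controlled by Bernoulli's inequality.\<close>
lemma fact_times_M_bound_ge:
  fixes \<theta> :: real
  assumes k: "k \<ge> 1" and s: "s \<le> n" and n: "n \<ge> k" and \<theta>: "real (k * k) \<le> \<theta> * n"
  shows "(q k (real s / real n) - \<theta>) * real n ^ k \<le> fact k * M_bound k n s"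
proof -
  have n0: "0 < real n" using k n by simp
  have "(1 + - real k / real n) ^ k \<ge> 1 + real k * (- real k / real n)"
    using n n0 by (intro Bernoulli_inequality) (simp add: field_simps)
  moreover have "real k * (real k / real n) \<le> \<theta>" using n0 \<theta> by (simp add: field_simps)
  ultimately have "1 - \<theta> \<le> (1 - real k / real n) ^ k" by simp
  then have "(1 - \<theta>) * real n ^ k \<le> (1 - real k / real n) ^ k * real n ^ k"
    by (rule mult_right_mono) simp
  also have "\<dots> = (real n - real k) ^ k"
    using n0 by (simp add: power_mult_distrib[symmetric] field_simps)
  also have "\<dots> = (\<Prod>i = 0..<k. real n - real k)" by simp
  also have "\<dots> \<le> (\<Prod>i = 0..<k. real n - real i)"
    using n by (intro prod_mono) auto
  also have "\<dots> = fact k * real (n choose k)"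
    by (simp add: binomial_gbinomial gbinomial_mult_fact)
  finally have lower: "(1 - \<theta>) * real n ^ k \<le> fact k * real (n choose k)" .
  have "real (((n - s) choose k) * fact k) \<le> real ((n - s) ^ k)"
    by (intro of_nat_mono binomial_fact_pow)
  also have "\<dots> = (1 - real s / real n) ^ k * real n ^ k"
    using n0 s by (simp add: power_mult_distrib[symmetric] field_simps of_nat_diff)
  finally have "fact k * real ((n - s) choose k) \<le> (1 - real s / real n) ^ k * real n ^ k"
    by (simp add: mult.commute)
  with lower show ?thesis unfolding M_bound_def q_def by (simp add: algebra_simps)
qed

section \<open>Stability\<close>

text \<open>Covered edges meet the set \<open>T\<close> of heavy vertices.  Changing \<open>T\<close> to a set \<open>S\<close> of size
  \<open>s\<close> loses only the edges through the few vertices of \<open>T - S\<close>.  This bounds \<open>F - \<A>(S)\<close>, and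
  the lower bound on \<open>|F|\<close> turns it into a bound on \<open>\<A>(S) - F\<close>.\<close>
lemma cover_support_gives_star:
  fixes W :: "nat \<Rightarrow> real" and \<rho> \<gamma> \<epsilon> :: real
  assumes k: "k \<ge> 1" and n: "n \<ge> 1" and s: "s \<le> n" and F: "F \<subseteq> [{1..n}]\<^bsup>k\<^esup>"
    and uncovered: "card {E \<in> F. sum W E < 1} \<le> \<gamma> * real n ^ k"
    and support: "card {v \<in> {1..n}. 1 / real k \<le> W v} \<le> s + \<rho> * n" and \<rho>: "0 \<le> \<rho>"
    and large: "M_bound k n s - \<epsilon> * real n ^ k \<le> card F"
  shows "\<exists>S \<in> [{1..n}]\<^bsup>s\<^esup>. card (sym_diff F (meeting_family k n S)) \<le> (\<epsilon> + 2 * \<gamma> + 2 * \<rho>) * real n ^ k"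
proof -
  define T where "T = {v \<in> {1..n}. 1 / real k \<le> W v}"
  have T: "finite T" "T \<subseteq> {1..n}" "card T \<le> s + \<rho> * n" using support by (auto simp: T_def)
  obtain S where S: "S \<in> [{1..n}]\<^bsup>s\<^esup>" and TS: "card (T - S) \<le> \<rho> * n"
  proof (cases "card T \<le> s")
    case True
    then obtain S where "T \<subseteq> S" "S \<subseteq> {1..n}" "card S = s"
      using exists_subset_between[of T s "{1..n}"] T s by auto
    moreover from this have "card (T - S) \<le> \<rho> * n" using \<rho> by (simp add: Diff_eq_empty_iff[THEN iffD2])
    ultimately show ?thesis by (intro that[of S]) (auto simp: nsets_def intro: finite_subset)
  next
    case False
    then obtain S where S: "S \<subseteq> T" "card S = s" "finite S"
      using obtain_subset_with_card_n[of s T] by auto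
    then have "card (T - S) = card T - s" by (simp add: card_Diff_subset)
    then have "card (T - S) \<le> \<rho> * n" using T(3) False by simp
    then show ?thesis using S T by (intro that[of S]) (auto simp: nsets_def)
  qed
  let ?A = "meeting_family k n S"
  let ?B = "{E \<in> [{1..n}]\<^bsup>k\<^esup>. E \<inter> (T - S) \<noteq> {}}"
  let ?X = "{E \<in> F. sum W E < 1}"
  have fin: "finite ([{1..n}]\<^bsup>k\<^esup>)" by (rule finite_imp_finite_nsets) simp
  have finF: "finite F" using F fin by (rule finite_subset)
  have finA: "finite ?A" using fin by (simp add: meeting_family_def)
  have "F - ?A \<subseteq> ?X \<union> ?B"
  proof
    fix E assume E: "E \<in> F - ?A"
    then have En: "E \<in> [{1..n}]\<^bsup>k\<^esup>" using F by blast
    have "E \<inter> T \<noteq> {}" if "1 \<le> sum W E"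
    proof
      assume "E \<inter> T = {}"
      then have "W v < 1 / real k" if "v \<in> E" for v
        using that En by (force simp: T_def nsets_def)
      moreover have "finite E" "E \<noteq> {}" "card E = k" using En k by (auto simp: nsets_def)
      ultimately have "sum W E < (\<Sum>v\<in>E. 1 / real k)" by (intro sum_strict_mono)
      also have "\<dots> = 1" using \<open>card E = k\<close> k by simp
      finally show False using that by simp
    qed
    moreover have "E \<inter> S = {}" using E En by (auto simp: meeting_family_def)
    ultimately show "E \<in> ?X \<union> ?B" using E En by (cases "sum W E < 1") auto
  qed
  then have "card (F - ?A) \<le> card (?X \<union> ?B)" using finF fin by (intro card_mono) auto
  also have "\<dots> \<le> card ?X + card ?B" by (rule card_Un_le)
  finally have "real (card (F - ?A)) \<le> card ?X + card ?B" by simp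
  moreover have "real (card ?B) \<le> \<rho> * real n ^ k"
  proof -
    have "card ?B \<le> card (T - S) * n ^ (k - 1)"
      using card_meeting_sets_le[of "{1..n}" "T - S" k] T k by simp
    then have "real (card ?B) \<le> real (card (T - S)) * real n ^ (k - 1)"
      by (simp flip: of_nat_power of_nat_mult)
    also have "\<dots> \<le> (\<rho> * n) * real n ^ (k - 1)" using TS by (intro mult_right_mono) auto
    also have "\<dots> = \<rho> * real n ^ k" using k by (cases k) auto
    finally show ?thesis .
  qed
  ultimately have FA: "card (F - ?A) \<le> (\<gamma> + \<rho>) * real n ^ k"
    using uncovered by (simp add: algebra_simps)
  have split: "card X = card (X \<inter> Y) + card (X - Y)" if "finite X" for X Y :: "nat set set"
    using that by (subst card_Un_disjoint[symmetric]) (auto intro: arg_cong[where f = card])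
  have "card ?A + card (F - ?A) = card F + card (?A - F)"
    using split[OF finF, of ?A] split[OF finA, of F] by (simp add: Int_commute)
  then have "real (card (?A - F)) = real (card ?A) + real (card (F - ?A)) - real (card F)" by linarith
  then have "real (card (?A - F)) \<le> \<epsilon> * real n ^ k + card (F - ?A)"
    using large card_meeting_family[OF S] by simp
  moreover have "card (sym_diff F ?A) = card (F - ?A) + card (?A - F)"
    using finF finA by (intro card_Un_disjoint) auto
  ultimately have "card (sym_diff F ?A) \<le> (\<epsilon> + 2 * \<gamma> + 2 * \<rho>) * real n ^ k"
    using FA by (simp add: algebra_simps)
  then show ?thesis using S by blast
qed

theorem theorem4p1:
  fixes k :: nat and f a \<eta> :: real
  assumes "k \<ge> 2" and "f > real k"
    and "\<And>x (P :: (nat \<Rightarrow> real) measure) (Z :: nat \<Rightarrow> (nat \<Rightarrow> real) \<Rightarrow> real).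
      \<lbrakk>0 < x; x \<le> 1 / f; prob_space P; iid_vars P Z {1..k};
       \<forall>i\<in>{1..k}. \<forall>\<omega>\<in>space P. Z i \<omega> \<in> {0..1};
       \<forall>i\<in>{1..k}. prob_space.expectation P (Z i) \<le> x\<rbrakk> \<Longrightarrow>
      prob_space.prob P {\<omega> \<in> space P. (\<Sum>i=1..k. Z i \<omega>) \<ge> 1} \<le> q k x \<and>
      (prob_space.prob P {\<omega> \<in> space P. (\<Sum>i=1..k. Z i \<omega>) \<ge> 1} = q k x \<longleftrightarrow>
        (\<forall>i\<in>{1..k}. distr P borel (Z i) = mu x))"
    and "0 < a" and "a \<le> 1 / f" and "\<eta> > 0"
  shows "\<exists>\<epsilon>>0. \<exists>n0. \<forall>n\<ge>n0. \<forall>s::nat.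
    a * real n \<le> real s \<and> real s \<le> real n / f \<longrightarrow>
    (\<forall>F. F \<subseteq> [{1..n}]\<^bsup>k\<^esup> \<and> matching_number F \<le> s \<and>
         real (card F) \<ge> M_bound k n s - \<epsilon> * real n ^ k \<longrightarrow>
      (\<exists>S \<in> [{1..n}]\<^bsup>s\<^esup>. real (card (sym_diff F (meeting_family k n S))) \<le> \<eta> * real n ^ k))"
proof -
  have k1: "k \<ge> 1" and k2: "k \<ge> 2" using assms(1) by auto
  have f1: "1 < f" using assms(1,2) by linarith
  have ext: "two_point_extremal k f"
    unfolding two_point_extremal_def using assms(3) by blast
  \<comment> \<open>The final error is \<open>(3 \<epsilon> + 2 \<rho>) n\<^sup>k\<close>, where \<open>\<epsilon>\<close> serves both for the defect of \<open>|F|\<close> and for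
    the number of uncovered edges.\<close>
  define \<rho> where "\<rho> = \<eta> / 8"
  have \<rho>: "0 < \<rho>" using assms(6) by (simp add: \<rho>_def)
  from law_stability[OF ext k2 assms(4) \<rho>] obtain \<delta> :: real where \<delta>: "0 < \<delta>"
    and stable: "\<And>(V :: nat set) W x. \<lbrakk>finite V; V \<noteq> {}; \<forall>v\<in>V. W v \<in> {0..1}; a \<le> x; x \<le> 1 / f;
      sum W V \<le> (x + \<delta>) * card V;
      (q k x - \<delta>) * card V ^ k \<le> card {\<omega> \<in> {1..k} \<rightarrow>\<^sub>E V. 1 \<le> (\<Sum>j\<in>{1..k}. W (\<omega> j))}\<rbrakk>
      \<Longrightarrow> card {v \<in> V. 1 / real k \<le> W v} \<le> (x + \<rho>) * card V"
    by (elim exE conjE) (rule that, assumption, blast)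
  \<comment> \<open>In terms of tuples, the defect of \<open>|F|\<close>, the uncovered edges and the tuples with repeated
    entries may each cost \<open>\<delta>/3\<close>.\<close>
  define \<epsilon> where "\<epsilon> = min (\<eta> / 8) (\<delta> / (3 * fact k))"
  have \<epsilon>: "0 < \<epsilon>" "\<epsilon> \<le> \<eta> / 8" "fact k * \<epsilon> \<le> \<delta> / 3"
  proof -
    show "0 < \<epsilon>" "\<epsilon> \<le> \<eta> / 8" using \<delta> assms(6) by (auto simp: \<epsilon>_def)
    have "fact k * \<epsilon> \<le> fact k * (\<delta> / (3 * fact k))" by (intro mult_left_mono) (auto simp: \<epsilon>_def)
    then show "fact k * \<epsilon> \<le> \<delta> / 3" by simp
  qed
  have "0 < \<delta> / 2" using \<delta> by simp
  from fractional_cover_of_almost_all[OF k1 this \<epsilon>(1)] obtain C :: real where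
    C: "\<And>(V :: nat set) F s. \<lbrakk>finite V; V \<noteq> {}; F \<subseteq> [V]\<^bsup>k\<^esup>; matching_number F \<le> s; s \<le> card V\<rbrakk> \<Longrightarrow>
    \<exists>W :: nat \<Rightarrow> real. (\<forall>v\<in>V. W v \<in> {0..1}) \<and> sum W V \<le> s + \<delta> / 2 * card V + C \<and>
      card {E \<in> F. sum W E < 1} \<le> \<epsilon> * card V ^ k" by blast
  define n0 where "n0 = Max {k, nat \<lceil>2 * C / \<delta>\<rceil>, nat \<lceil>3 * real (k * k) / \<delta>\<rceil>}"
  show ?thesis
  proof (intro exI[of _ \<epsilon>] conjI \<epsilon>(1) exI[of _ n0] allI impI, elim conjE)
    fix n s F assume n: "n0 \<le> n" and as: "a * real n \<le> real s" and sf: "real s \<le> real n / f"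
      and F: "F \<subseteq> [{1..n}]\<^bsup>k\<^esup>" and \<nu>: "matching_number F \<le> s"
      and large: "M_bound k n s - \<epsilon> * real n ^ k \<le> real (card F)"
    have nk: "k \<le> n" and "nat \<lceil>2 * C / \<delta>\<rceil> \<le> n" "nat \<lceil>3 * real (k * k) / \<delta>\<rceil> \<le> n"
      using n by (auto simp: n0_def)
    then have "2 * C / \<delta> \<le> n" "3 * real (k * k) / \<delta> \<le> n" by linarith+
    then have nC: "C \<le> \<delta> / 2 * n" and nkk: "real (k * k) \<le> \<delta> / 3 * n"
      using \<delta> by (simp_all add: field_simps)
    have n1: "n \<ge> 1" using nk k1 by simp
    have "real s \<le> real n"
    proof -
      have "real n / f \<le> real n / 1" using f1 by (intro divide_left_mono) auto
      then show ?thesis using sf by simp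
    qed
    then have s: "s \<le> n" by simp
    have cV: "card {1..n} = n" and V: "finite {1..n}" "{1..n} \<noteq> {}" using n1 by auto
    obtain W :: "nat \<Rightarrow> real" where W: "\<forall>v\<in>{1..n}. W v \<in> {0..1}"
      and total: "sum W {1..n} \<le> s + \<delta> / 2 * n + C"
      and uncovered: "card {E \<in> F. sum W E < 1} \<le> \<epsilon> * real n ^ k"
      using C[OF V F \<nu>] s by auto
    define x where "x = real s / real n"
    have xs: "x * n = s" using n1 by (simp add: x_def)
    have x: "a \<le> x" "x \<le> 1 / f" using as sf n1 f1 by (simp_all add: x_def field_simps)
    have mean: "sum W {1..n} \<le> (x + \<delta>) * card {1..n}"
      using total nC xs by (simp add: cV algebra_simps)
    define F' where "F' = {E \<in> F. 1 \<le> sum W E}"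
    have F': "F' \<subseteq> [{1..n}]\<^bsup>k\<^esup>" using F by (auto simp: F'_def)
    have finF: "finite F" using F finite_imp_finite_nsets[OF V(1)] by (rule finite_subset)
    have "card F \<le> card F' + card {E \<in> F. sum W E < 1}"
    proof -
      have "F = F' \<union> {E \<in> F. sum W E < 1}" by (auto simp: F'_def)
      then show ?thesis using card_Un_le by metis
    qed
    then have cF': "M_bound k n s - 2 * \<epsilon> * real n ^ k \<le> card F'"
      using large uncovered by linarith
    have "(q k x - \<delta>) * real n ^ k = (q k x - \<delta> / 3) * real n ^ k - 2 * (\<delta> / 3) * real n ^ k"
      by (simp add: algebra_simps)
    also have "\<dots> \<le> fact k * M_bound k n s - 2 * (fact k * \<epsilon>) * real n ^ k"
      unfolding x_def
      by (intro diff_mono fact_times_M_bound_ge[OF k1 s nk nkk] mult_right_mono mult_left_mono \<epsilon>(3)) auto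
    also have "\<dots> = fact k * (M_bound k n s - 2 * \<epsilon> * real n ^ k)" by (simp add: algebra_simps)
    also have "\<dots> \<le> fact k * real (card F')" using cF' by (intro mult_left_mono) auto
    also have "\<dots> \<le> real (card (edge_tuples k {1..n} F'))"
      using card_enumerations_ge[OF V(1) F'] by (metis of_nat_fact of_nat_le_iff of_nat_mult)
    also have "\<dots> \<le> card {\<omega> \<in> {1..k} \<rightarrow>\<^sub>E {1..n}. 1 \<le> (\<Sum>j\<in>{1..k}. W (\<omega> j))}"
    proof -
      have "edge_tuples k {1..n} F' \<subseteq> {\<omega> \<in> {1..k} \<rightarrow>\<^sub>E {1..n}. 1 \<le> (\<Sum>j\<in>{1..k}. W (\<omega> j))}"
      proof
        fix \<omega> assume \<omega>: "\<omega> \<in> edge_tuples k {1..n} F'"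
        then have "\<omega> ` {1..k} \<in> F'" by (simp add: edge_tuples_def)
        then have "(\<Sum>j\<in>{1..k}. W (\<omega> j)) = sum W (\<omega> ` {1..k})" "1 \<le> sum W (\<omega> ` {1..k})"
          using sum_enumeration[of \<omega> k "{1..n}" W] F' by (auto simp: F'_def)
        then show "\<omega> \<in> {\<omega> \<in> {1..k} \<rightarrow>\<^sub>E {1..n}. 1 \<le> (\<Sum>j\<in>{1..k}. W (\<omega> j))}"
          using \<omega> by (simp add: edge_tuples_def)
      qed
      moreover have "finite ({1..k} \<rightarrow>\<^sub>E {1..n})" by (intro finite_PiE) auto
      ultimately show ?thesis by (intro of_nat_mono card_mono) auto
    qed
    finally have prob: "(q k x - \<delta>) * card {1..n} ^ k
      \<le> card {\<omega> \<in> {1..k} \<rightarrow>\<^sub>E {1..n}. 1 \<le> (\<Sum>j\<in>{1..k}. W (\<omega> j))}" by (simp add: cV)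
    have "card {v \<in> {1..n}. 1 / real k \<le> W v} \<le> (x + \<rho>) * card {1..n}"
      by (rule stable[OF V W x mean prob])
    then have support: "card {v \<in> {1..n}. 1 / real k \<le> W v} \<le> s + \<rho> * n"
      using xs by (simp add: cV algebra_simps)
    obtain S where S: "S \<in> [{1..n}]\<^bsup>s\<^esup>"
      and "card (sym_diff F (meeting_family k n S)) \<le> (\<epsilon> + 2 * \<epsilon> + 2 * \<rho>) * real n ^ k"
      using cover_support_gives_star[OF k1 n1 s F uncovered support _ large] \<rho> by auto
    moreover have "(\<epsilon> + 2 * \<epsilon> + 2 * \<rho>) * real n ^ k \<le> \<eta> * real n ^ k"
      using \<epsilon>(2) assms(6) by (intro mult_right_mono) (auto simp: \<rho>_def)
    ultimately show "\<exists>S \<in> [{1..n}]\<^bsup>s\<^esup>. real (card (sym_diff F (meeting_family k n S))) \<le> \<eta> * real n ^ k"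
      by (intro bexI[of _ S]) auto
  qed
qed

end
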